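(* Let $\mu_{Tr}(C)$ and $\mu_{Ht}(C)$ denote the translation order and the homothety order of a convex curve $C\subset\mathbb{R}^2$. (i) If $C$ is a convex curve, then $\mu_{Tr}(C)\le 6$ and $\mu_{Ht}(C)\le 6$. (ii) If $C$ is a strictly convex curve, then $\mu_{Tr}(C)\le 4$ and $\mu_{Ht}(C)\le 4$. (iii) If $C$ is strictly convex and bounded, then $\mu_{Tr}(C)=4$ and $\mu_{Ht}(C)=4$; if $C$ is strictly convex and unbounded, then $\mu_{Tr}(C)=3$.
   Context: A convex curve is the boundary $C=\partial B$ of a proper convex subset $B$ of the Euclidean plane $\mathbb{R}^2$. A strictly convex curve is a convex curve containing no line segment. A homothet of $C$ is any set of the form $\lambda C+v$ with $\lambda>0$ and $v\in\mathbb{R}^2$; it is called a translate of $C$ if $\lambda=1$. The translation order $\mu_{Tr}(C)$ is the minimal number $\mu$ with the following property: for any subset $S\subset\mathbb{R}^2$, if for every $S_0\subset S$ with $\sharp S_0\le\mu$ there is a translate of $C$ (depending on $S_0$) containing $S_0$, then there exists a translate of $C$ containing the whole set $S$. The homothety order $\mu_{Ht}(C)$ is defined analogously, with "homothet" in place of "translate". Here $\sharp$ denotes cardinality.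
   Formalization: Part (i) fails for arbitrary S (quadrant or square, S a line along a side). Proved: both bounds for compact S; for all S, the translation bound if half-lines in C extend to lines in C, the homothety bound if segments do. Empty and one-point C are excluded. *)

theory Defs
  imports "HOL-Analysis.Analysis"
begin

(* The last condition excludes the empty set and single points, which are not curves although
   they are boundaries of proper convex sets. *)
definition convex_curve :: "(real^2) set \<Rightarrow> bool" where
  "convex_curve C \<longleftrightarrow>
     (\<exists>B. convex B \<and> B \<noteq> UNIV \<and> C = frontier B) \<and> (\<exists>p\<in>C. \<exists>q\<in>C. p \<noteq> q)"

definition strictly_convex_curve :: "(real^2) set \<Rightarrow> bool" where
  "strictly_convex_curve C \<longleftrightarrow>
     convex_curve C \<and> \<not> (\<exists>a b. a \<noteq> b \<and> closed_segment a b \<subseteq> C)"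

definition translates :: "(real^2) set \<Rightarrow> (real^2) set set" where
  "translates C = {(\<lambda>x. x + v) ` C | v. True}"

definition homothets :: "(real^2) set \<Rightarrow> (real^2) set set" where
  "homothets C = {(\<lambda>x. r *\<^sub>R x + v) ` C | r v. r > 0}"

definition containment_property ::
    "((real^2) set \<Rightarrow> bool) \<Rightarrow> (real^2) set set \<Rightarrow> nat \<Rightarrow> bool" where
  "containment_property P F m \<longleftrightarrow>
     (\<forall>S. P S \<longrightarrow>
        (\<forall>S0. S0 \<subseteq> S \<and> finite S0 \<and> card S0 \<le> m \<longrightarrow> (\<exists>T\<in>F. S0 \<subseteq> T)) \<longrightarrow>
        (\<exists>T\<in>F. S \<subseteq> T))"

(* The least number with the property; the infimum is infinity if there is no such number. *)
definition containment_order ::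
    "((real^2) set \<Rightarrow> bool) \<Rightarrow> (real^2) set set \<Rightarrow> enat" where
  "containment_order P F = Inf (enat ` {m. containment_property P F m})"

definition translation_order :: "(real^2) set \<Rightarrow> enat" where
  "translation_order C = containment_order (\<lambda>S. True) (translates C)"

definition homothety_order :: "(real^2) set \<Rightarrow> enat" where
  "homothety_order C = containment_order (\<lambda>S. True) (homothets C)"

(* Variants in which only compact sets S are tested.  Over arbitrary S the orders of a curve
   with straight pieces can be infinite: for the boundary C of a quadrant (translates) or of a
   square (homothets), the line S spanned by a side of C is not covered, although all of its
   finite subsets are. *)
definition compact_translation_order :: "(real^2) set \<Rightarrow> enat" where
  "compact_translation_order C = containment_order compact (translates C)"

definition compact_homothety_order :: "(real^2) set \<Rightarrow> enat" where
  "compact_homothety_order C = containment_order compact (homothets C)"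

(* These say when the phenomenon above does not occur. *)
definition halflines_extend :: "(real^2) set \<Rightarrow> bool" where
  "halflines_extend C \<longleftrightarrow>
     (\<forall>p u. u \<noteq> 0 \<and> (\<forall>t\<ge>0. p + t *\<^sub>R u \<in> C) \<longrightarrow> (\<forall>t. p + t *\<^sub>R u \<in> C))"

definition segments_extend :: "(real^2) set \<Rightarrow> bool" where
  "segments_extend C \<longleftrightarrow>
     (\<forall>p u. u \<noteq> 0 \<and> (\<forall>t\<in>{0..1}. p + t *\<^sub>R u \<in> C) \<longrightarrow> (\<forall>t. p + t *\<^sub>R u \<in> C))"

end

theory Submission
  imports Defs
begin

text \<open>
  If a homothety maps three non-collinear points of the boundary \<open>C\<close> of a closed convex set into
  \<open>C\<close>, then two of them lie on a line through the centre (parallel to the translation vector, if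
  the ratio is 1): otherwise one of the six points is interior to a triangle formed by three
  others. Hence distinct homothets of \<open>C\<close> do not share five points in general position, and share
  at most two points if \<open>C\<close> is strictly convex. So five points of \<open>S\<close> in general position (or three
  points, if \<open>C\<close> is strictly convex) determine the covering homothet, and one further point
  suffices. The convex hull of a compact \<open>S\<close> without five such points has at most four corners, and
  \<open>S\<close> lies on its sides; a homothet covers \<open>S\<close> as soon as it contains the corners and, for each
  side with a point of \<open>S\<close> in its interior, one such point. These are at most six points, since
  inner points on three sides of a quadrangle would give five points in general position.
  For translates of a curve without half-lines, arbitrary \<open>S\<close> reduce to finite ones by compactness.

  For an unbounded strictly convex \<open>C\<close> a pair of points lies in at most one translate, and the
  reflection of a triangle inscribed in \<open>C\<close> shows that testing pairs is not enough. For a bounded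
  one, a centrally symmetric hexagon is inscribed in \<open>C\<close>, which yields four points that are not
  covered although any three of them are.
\<close>

subsection \<open>Plane geometry\<close>

definition det2 :: "real^2 \<Rightarrow> real^2 \<Rightarrow> real" where
  "det2 u v = u$1 * v$2 - u$2 * v$1"

lemma det2_add_left: "det2 (u + v) w = det2 u w + det2 v w"
  and det2_add_right: "det2 w (u + v) = det2 w u + det2 w v"
  and det2_diff_left: "det2 (u - v) w = det2 u w - det2 v w"
  and det2_diff_right: "det2 w (u - v) = det2 w u - det2 w v"
  and det2_scaleR_left: "det2 (c *\<^sub>R u) w = c * det2 u w"
  and det2_scaleR_right: "det2 w (c *\<^sub>R u) = c * det2 w u"
  and det2_minus_left: "det2 (- u) w = - det2 u w"
  and det2_minus_right: "det2 w (- u) = - det2 w u"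
  by (simp_all add: det2_def algebra_simps)

lemma det2_self [simp]: "det2 u u = 0"
  and det2_zero_left [simp]: "det2 0 u = 0"
  and det2_zero_right [simp]: "det2 u 0 = 0"
  by (simp_all add: det2_def)

lemmas det2_simps = det2_add_left det2_add_right det2_diff_left det2_diff_right
  det2_scaleR_left det2_scaleR_right det2_minus_left det2_minus_right

lemma continuous_on_det2 [continuous_intros]:
  assumes "continuous_on S f" "continuous_on S g"
  shows "continuous_on S (\<lambda>x. det2 (f x) (g x))"
  unfolding det2_def using assms by (intro continuous_intros)

text \<open>Cramer's rule in the basis \<open>u\<close>, \<open>v\<close>.\<close>

lemma det2_basis:
  assumes "det2 u v \<noteq> 0"
  shows "z = (det2 z v / det2 u v) *\<^sub>R u + (det2 u z / det2 u v) *\<^sub>R v"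
proof -
  have "det2 u v *\<^sub>R z = det2 z v *\<^sub>R u + det2 u z *\<^sub>R v"
    by (simp add: vec_eq_iff forall_2 det2_def algebra_simps)
  then have "z = inverse (det2 u v) *\<^sub>R (det2 z v *\<^sub>R u + det2 u z *\<^sub>R v)"
    using assms by (metis (no_types) scaleR_scaleR left_inverse scaleR_one)
  then show ?thesis
    by (simp add: scaleR_add_right divide_inverse mult.commute)
qed

text \<open>The vector \<open>(u \<bullet> u) v - (u \<bullet> v) u\<close> is
  \<open>det2 u v\<close> times \<open>u\<close> rotated by a right angle, so it vanishes
  here.\<close>

lemma det2_eq_0_imp_parallel:
  assumes "det2 u v = 0" "u \<noteq> 0"
  obtains t where "v = t *\<^sub>R u"
proof -
  have "(u \<bullet> u) *\<^sub>R v = (u \<bullet> v) *\<^sub>R u"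
    using assms(1)
    by (simp add: vec_eq_iff forall_2 det2_def inner_vec_def sum_2 algebra_simps)
  then have "v = ((u \<bullet> v) / (u \<bullet> u)) *\<^sub>R u"
    using assms(2)
    by (metis (no_types) divide_inverse_commute inner_eq_zero_iff left_inverse scaleR_one scaleR_scaleR)
  then show ?thesis
    using that by blast
qed

lemma orthogonal_imp_det2_eq_0:
  assumes "n \<noteq> 0" "n \<bullet> u = 0" "n \<bullet> v = 0"
  shows "det2 u v = 0"
proof (rule ccontr)
  assume "det2 u v \<noteq> 0"
  then have "n \<bullet> n = 0"
    using det2_basis[of u v n] assms(2,3)
    by (metis add.right_neutral inner_add_right inner_scaleR_right mult_zero_right)
  with assms(1) show False
    by simp
qed

text \<open>Twice the signed area of the triangle \<open>p q r\<close>: positive for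
  counterclockwise order, zero exactly for collinear points.\<close>

definition orient :: "real^2 \<Rightarrow> real^2 \<Rightarrow> real^2 \<Rightarrow> real" where
  "orient p q r = det2 (q - p) (r - p)"

lemma orient_rotate: "orient q r p = orient p q r"
  by (simp add: orient_def det2_def algebra_simps)

lemma orient_swap: "orient q p r = - orient p q r" "orient p r q = - orient p q r"
  by (simp_all add: orient_def det2_def algebra_simps)

lemma orient_same [simp]: "orient p p q = 0" "orient p q q = 0" "orient p q p = 0"
  by (simp_all add: orient_def det2_def algebra_simps)

lemma orient_barycentric:
  assumes "orient p q r \<noteq> 0"
  obtains s t where "z = p + s *\<^sub>R (q - p) + t *\<^sub>R (r - p)"
proof -
  let ?s = "det2 (z - p) (r - p) / det2 (q - p) (r - p)"
  let ?t = "det2 (q - p) (z - p) / det2 (q - p) (r - p)"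
  have "z - p = ?s *\<^sub>R (q - p) + ?t *\<^sub>R (r - p)"
    using assms unfolding orient_def by (rule det2_basis)
  then have "z = p + (?s *\<^sub>R (q - p) + ?t *\<^sub>R (r - p))"
    unfolding diff_eq_eq by (simp only: add.commute)
  then show ?thesis
    using that[of ?s ?t] by (simp only: add.assoc)
qed

lemma orient_convex_left:
  "orient ((1 - t) *\<^sub>R p + t *\<^sub>R q) r s = (1 - t) * orient p r s + t * orient q r s"
  by (simp add: orient_def det2_def algebra_simps)

text \<open>A convex set without interior lies in a hyperplane, whose normal is constant on it.
  Otherwise the relative interior is the interior, and a supporting hyperplane at a relative
  boundary point serves.\<close>

lemma supporting_functional:
  fixes A :: "'a::euclidean_space set"
  assumes "convex A" "closed A" "x \<in> frontier A"
  obtains n where "n \<noteq> 0" "\<And>y. y \<in> A \<Longrightarrow> n \<bullet> x \<le> n \<bullet> y"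
proof (cases "interior A = {}")
  case True
  then obtain n b where "n \<noteq> 0" "A \<subseteq> {x. n \<bullet> x = b}"
    using empty_interior_subset_hyperplane assms(1) by metis
  moreover have "x \<in> A"
    using assms(2,3) frontier_subset_closed by blast
  moreover have "n \<bullet> y = b" if "y \<in> A" for y
    using \<open>A \<subseteq> _\<close> that by blast
  ultimately have "n \<bullet> x \<le> n \<bullet> y" if "y \<in> A" for y
    using that by simp
  then show ?thesis
    using that \<open>n \<noteq> 0\<close> by blast
next
  case False
  then have "x \<notin> rel_interior A" "x \<in> closure A"
    using assms(3) rel_interior_nonempty_interior[of A] unfolding frontier_def by auto
  then obtain n where "n \<noteq> 0" "\<And>y. y \<in> closure A \<Longrightarrow> n \<bullet> x \<le> n \<bullet> y"
    using supporting_hyperplane_relative_frontier[OF assms(1)] by blast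
  then show ?thesis
    using that closure_subset[of A] by blast
qed

text \<open>Moving from \<open>x\<close> against \<open>n\<close> leaves \<open>A\<close> at
  once.\<close>

lemma frontier_if_minimizes:
  fixes A :: "'a::euclidean_space set"
  assumes "n \<noteq> 0" "x \<in> A" "\<And>y. y \<in> A \<Longrightarrow> n \<bullet> x \<le> n \<bullet> y"
  shows "x \<in> frontier A"
proof -
  have "x \<notin> interior A"
  proof
    assume "x \<in> interior A"
    then obtain e where e: "e > 0" "cball x e \<subseteq> A"
      by (meson mem_interior_cball)
    have "x - (e / norm n) *\<^sub>R n \<in> cball x e"
      using e(1) assms(1) by (simp add: dist_norm)
    then have "n \<bullet> x \<le> n \<bullet> (x - (e / norm n) *\<^sub>R n)"
      using e(2) assms(3) by blast
    then have "(e / norm n) * (n \<bullet> n) \<le> 0"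
      by (simp add: inner_diff_right)
    moreover have "(e / norm n) * (n \<bullet> n) > 0"
      using e(1) assms(1) by simp
    ultimately show False
      by simp
  qed
  then show ?thesis
    using assms(2) closure_subset unfolding frontier_def by blast
qed

text \<open>The position \<open>t\<close> of \<open>r\<close> on the line, with \<open>p\<close> at
  0 and \<open>q\<close> at 1, decides which of the three points is the middle one.\<close>

lemma collinear_between:
  assumes "orient p q r = 0" "p \<noteq> q" "q \<noteq> r" "p \<noteq> r"
  shows "p \<in> open_segment r q \<or> r \<in> open_segment p q \<or> q \<in> open_segment p r"
proof -
  have "q - p \<noteq> 0" using assms by simp
  then obtain t where t: "r - p = t *\<^sub>R (q - p)"
    using assms(1) det2_eq_0_imp_parallel unfolding orient_def by blast
  then have r: "r = p + t *\<^sub>R (q - p)"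
    by (metis add.commute diff_add_cancel)
  have t01: "t \<noteq> 0" "t \<noteq> 1"
    using r assms by auto
  consider "t < 0" | "0 < t" "t < 1" | "1 < t"
    using t01 by linarith
  then show ?thesis
  proof cases
    case 1
    define s where "s = - t / (1 - t)"
    have "(1 - s) * t + s = 0"
      using 1 by (simp add: s_def field_simps)
    moreover have "(1 - s) *\<^sub>R r + s *\<^sub>R q = p + ((1 - s) * t + s) *\<^sub>R (q - p)"
      unfolding r by (simp add: algebra_simps)
    ultimately have "p = (1 - s) *\<^sub>R r + s *\<^sub>R q"
      by simp
    moreover have "0 < s" "s < 1"
      using 1 by (simp_all add: s_def field_simps)
    ultimately show ?thesis
      using assms unfolding in_segment by blast
  next
    case 2
    have "r = (1 - t) *\<^sub>R p + t *\<^sub>R q"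
      unfolding r by (simp add: algebra_simps)
    then show ?thesis
      using 2 assms unfolding in_segment by blast
  next
    case 3
    have "q = (1 - 1 / t) *\<^sub>R p + (1 / t) *\<^sub>R r"
      unfolding r using 3 by (simp add: algebra_simps)
    moreover have "0 < 1 / t" "1 / t < 1"
      using 3 by simp_all
    ultimately show ?thesis
      using assms unfolding in_segment by blast
  qed
qed

section \<open>Segments and triangles at the boundary of a closed convex set\<close>

locale convex_body =
  fixes A :: "(real^2) set"
  assumes closed: "closed A" and convex: "convex A"
begin

abbreviation C :: "(real^2) set" where "C \<equiv> frontier A"

lemma C_subset: "C \<subseteq> A"
  using closed frontier_subset_closed by blast

lemma C_interior: "x \<in> C \<Longrightarrow> x \<notin> interior A"
  by (simp add: frontier_def)

lemma C_iff: "x \<in> C \<longleftrightarrow> x \<in> A \<and> x \<notin> interior A"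
  using closed by (simp add: frontier_def closure_closed)

text \<open>The supporting functional at \<open>m\<close> attains its minimum over the segment at an
  inner point, hence is constant there; so every point of the segment minimizes it over
  \<open>A\<close>.\<close>

lemma segment_in_frontier:
  assumes "m \<in> C" "m \<in> open_segment p q" "p \<in> A" "q \<in> A"
  shows "closed_segment p q \<subseteq> C"
proof
  fix x assume x: "x \<in> closed_segment p q"
  obtain n where n: "n \<noteq> 0" "\<And>y. y \<in> A \<Longrightarrow> n \<bullet> m \<le> n \<bullet> y"
    using supporting_functional[OF convex closed assms(1)] by blast
  obtain t where t: "0 < t" "t < 1" "m = (1 - t) *\<^sub>R p + t *\<^sub>R q"
    using assms(2) by (auto simp: in_segment)
  have le: "n \<bullet> m \<le> n \<bullet> p" "n \<bullet> m \<le> n \<bullet> q"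
    using n assms by auto
  have "(1 - t) * (n \<bullet> p - n \<bullet> m) + t * (n \<bullet> q - n \<bullet> m) = 0"
    unfolding t(3) by (simp add: inner_simps algebra_simps)
  moreover have "(1 - t) * (n \<bullet> p - n \<bullet> m) \<ge> 0" "t * (n \<bullet> q - n \<bullet> m) \<ge> 0"
    using le t by simp_all
  ultimately have "(1 - t) * (n \<bullet> p - n \<bullet> m) = 0" "t * (n \<bullet> q - n \<bullet> m) = 0"
    by linarith+
  then have eq: "n \<bullet> p = n \<bullet> m" "n \<bullet> q = n \<bullet> m"
    using t by simp_all
  obtain s where s: "x = (1 - s) *\<^sub>R p + s *\<^sub>R q"
    using x by (auto simp: in_segment)
  have "n \<bullet> x = n \<bullet> m"
    unfolding s using eq by (simp add: inner_simps algebra_simps)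
  moreover have "x \<in> A"
    using x assms(3,4) convex closed_segment_subset by blast
  ultimately show "x \<in> C"
    using frontier_if_minimizes[of n x A] n by simp
qed

text \<open>A boundary point is never interior to a genuine triangle with corners in
  \<open>A\<close>, since the supporting functional at \<open>x\<close> would be constant on
  \<open>p\<close>, \<open>q\<close>, \<open>r\<close>. The weights are not normalized, which spares
  divisions in the applications.\<close>

lemma collinear_if_frontier_combination:
  assumes "x \<in> C" "p \<in> A" "q \<in> A" "r \<in> A" "a > 0" "b > 0" "c > 0"
    and eq: "(a + b + c) *\<^sub>R x = a *\<^sub>R p + b *\<^sub>R q + c *\<^sub>R r"
  shows "orient p q r = 0"
proof -
  obtain n where n: "n \<noteq> 0" "\<And>y. y \<in> A \<Longrightarrow> n \<bullet> x \<le> n \<bullet> y"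
    using supporting_functional[OF convex closed assms(1)] by blast
  have "(a + b + c) * (n \<bullet> x) = a * (n \<bullet> p) + b * (n \<bullet> q) + c * (n \<bullet> r)"
    using arg_cong[OF eq, of "\<lambda>z. n \<bullet> z"] by (simp add: inner_simps)
  then have "a * (n \<bullet> p - n \<bullet> x) + b * (n \<bullet> q - n \<bullet> x) + c * (n \<bullet> r - n \<bullet> x) = 0"
    by (simp add: algebra_simps)
  moreover have "a * (n \<bullet> p - n \<bullet> x) \<ge> 0" "b * (n \<bullet> q - n \<bullet> x) \<ge> 0" "c * (n \<bullet> r - n \<bullet> x) \<ge> 0"
    using n assms by simp_all
  ultimately have "a * (n \<bullet> p - n \<bullet> x) = 0" "b * (n \<bullet> q - n \<bullet> x) = 0" "c * (n \<bullet> r - n \<bullet> x) = 0"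
    by linarith+
  then have "n \<bullet> (q - p) = 0" "n \<bullet> (r - p) = 0"
    using assms by (simp_all add: inner_diff_right)
  then show ?thesis
    unfolding orient_def using orthogonal_imp_det2_eq_0 n(1) by blast
qed

lemma segment_if_collinear:
  assumes "p \<in> C" "q \<in> C" "r \<in> C" "p \<noteq> q" "q \<noteq> r" "p \<noteq> r" "orient p q r = 0"
  obtains a b where "a \<noteq> b" "closed_segment a b \<subseteq> C"
  using collinear_between[OF assms(7,4-6)] segment_in_frontier assms C_subset that
  by (metis subsetD)

end

section \<open>Homotheties that map three boundary points into the boundary\<close>

context convex_body
begin

text \<open>The image of \<open>r\<close> has barycentric coordinates \<open>a\<close>,
  \<open>b\<close>, \<open>k + c\<close>, all positive, so it is inside the triangle
  \<open>p q r\<close>.\<close>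

lemma no_three_homothetic_positive:
  assumes C: "p \<in> C" "q \<in> C" "r \<in> C" "k *\<^sub>R r + w \<in> C"
    and "a > 0" "b > 0" "c > 0" "k > 0" "a + b + c = 1 - k"
    and w: "w = a *\<^sub>R p + b *\<^sub>R q + c *\<^sub>R r"
  shows "orient p q r = 0"
proof (rule collinear_if_frontier_combination[OF C(4)])
  show "(a + b + (k + c)) *\<^sub>R (k *\<^sub>R r + w) = a *\<^sub>R p + b *\<^sub>R q + (k + c) *\<^sub>R r"
    using assms(9) unfolding w by (simp add: algebra_simps)
qed (use assms C_subset in auto)

text \<open>Now the image of \<open>r\<close> is a positive combination of \<open>r\<close> and the
  images of \<open>p\<close> and \<open>q\<close>. If these three are collinear, so are the three
  images, and hence \<open>p\<close>, \<open>q\<close>, \<open>r\<close>.\<close>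

lemma no_three_homothetic_one_negative:
  assumes C: "p \<in> C" "q \<in> C" "r \<in> C"
      "k *\<^sub>R p + w \<in> C" "k *\<^sub>R q + w \<in> C" "k *\<^sub>R r + w \<in> C"
    and "a > 0" "b > 0" "c < 0" "k > 0" "a + b + c = 1 - k"
    and w: "w = a *\<^sub>R p + b *\<^sub>R q + c *\<^sub>R r"
  shows "orient p q r = 0"
proof -
  let ?f = "\<lambda>x. k *\<^sub>R x + w"
  have c: "c = 1 - k - a - b"
    using assms(11) by simp
  have eq: "(k + a + b) *\<^sub>R ?f r = k *\<^sub>R r + a *\<^sub>R ?f p + b *\<^sub>R ?f q"
    unfolding w c by (simp add: algebra_simps)
  have 0: "orient r (?f p) (?f q) = 0"
    using collinear_if_frontier_combination[OF C(6) _ _ _ _ _ _ eq] assms C_subset by blast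
  have "(k + a + b) * (k\<^sup>2 * orient p q r) = (k + a + b) * orient (?f p) (?f q) (?f r)"
    by (simp add: orient_def det2_def power2_eq_square algebra_simps)
  also have "\<dots> = det2 (?f q - ?f p) ((k + a + b) *\<^sub>R ?f r - (k + a + b) *\<^sub>R ?f p)"
    by (simp add: orient_def det2_simps algebra_simps)
  also have "\<dots> = k * orient r (?f p) (?f q)"
    unfolding eq by (simp add: orient_def det2_def algebra_simps)
  finally show ?thesis
    using 0 assms by simp
qed

text \<open>Here the roles are reversed: solving for \<open>r\<close> exhibits it as a positive
  combination of its own image, \<open>p\<close> and \<open>q\<close>.\<close>

lemma no_three_homothetic_two_negative:
  assumes C: "p \<in> C" "q \<in> C" "r \<in> C" "k *\<^sub>R r + w \<in> C"
    and "a < 0" "b < 0" "k > 0" "k \<le> 1" "a + b + c = 1 - k"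
    and w: "w = a *\<^sub>R p + b *\<^sub>R q + c *\<^sub>R r"
  shows "orient p q r = 0"
proof -
  let ?y = "k *\<^sub>R r + w"
  have c: "c = 1 - k - a - b"
    using assms(9) by simp
  have eq: "(1 + - a + - b) *\<^sub>R r = 1 *\<^sub>R ?y + (- a) *\<^sub>R p + (- b) *\<^sub>R q"
    unfolding w c by (simp add: algebra_simps)
  have 0: "orient ?y p q = 0"
    using collinear_if_frontier_combination[OF C(3) _ _ _ _ _ _ eq] assms C_subset by auto
  have "(1 + - a + - b) * orient p q r
      = det2 (q - p) ((1 + - a + - b) *\<^sub>R r - (1 + - a + - b) *\<^sub>R p)"
    by (simp add: orient_def det2_simps algebra_simps)
  also have "\<dots> = orient ?y p q"
    unfolding eq by (simp add: orient_def det2_def algebra_simps)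
  finally show ?thesis
    using 0 assms by simp
qed

end

text \<open>The pair \<open>x\<close>, \<open>y\<close> is collinear with the centre of the homothety
  \<open>x \<mapsto> k x + w\<close>, or parallel to \<open>w\<close> if \<open>k = 1\<close>.\<close>
definition aligned :: "real \<Rightarrow> real^2 \<Rightarrow> real^2 \<Rightarrow> real^2 \<Rightarrow> bool" where
  "aligned k w x y \<longleftrightarrow>
     (\<exists>s t. (k - 1) *\<^sub>R x + w = s *\<^sub>R (y - x) \<and> (k - 1) *\<^sub>R y + w = t *\<^sub>R (x - y))"

lemma aligned_commute: "aligned k w x y \<longleftrightarrow> aligned k w y x"
  unfolding aligned_def by blast

lemma alignedI:
  assumes "w = a *\<^sub>R x + b *\<^sub>R y" "a + b = 1 - k"
  shows "aligned k w x y"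
proof -
  have "(k - 1) *\<^sub>R x + w = b *\<^sub>R (y - x)" "(k - 1) *\<^sub>R y + w = a *\<^sub>R (x - y)"
    using assms(2) unfolding assms(1) by (simp_all add: algebra_simps flip: scaleR_add_left)
  then show ?thesis
    unfolding aligned_def by blast
qed

text \<open>Writing \<open>w\<close> in barycentric coordinates, any sign pattern without zeros puts one of the six
  points inside a triangle formed by three others.\<close>
lemma (in convex_body) homothetic_triangles_aligned:
  assumes C: "p \<in> C" "q \<in> C" "r \<in> C"
      "k *\<^sub>R p + w \<in> C" "k *\<^sub>R q + w \<in> C" "k *\<^sub>R r + w \<in> C"
    and k: "k > 0" "k \<le> 1" and nc: "orient p q r \<noteq> 0"
  shows "aligned k w p q \<or> aligned k w q r \<or> aligned k w p r"
proof -
  obtain b c where bc: "w + k *\<^sub>R p = p + b *\<^sub>R (q - p) + c *\<^sub>R (r - p)"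
    using orient_barycentric[OF nc] by blast
  define a where "a = 1 - k - b - c"
  have sum: "a + b + c = 1 - k"
    by (simp add: a_def)
  have "w = p + b *\<^sub>R (q - p) + c *\<^sub>R (r - p) - k *\<^sub>R p"
    using bc by (metis add_diff_cancel_right')
  then have w: "w = a *\<^sub>R p + b *\<^sub>R q + c *\<^sub>R r"
    by (simp add: a_def algebra_simps)
  have "a = 0 \<or> b = 0 \<or> c = 0"
  proof (rule ccontr)
    assume nz: "\<not> ?thesis"
    have rot: "orient q r p \<noteq> 0" "orient r p q \<noteq> 0"
      using nc orient_rotate by metis+
    have w': "w = b *\<^sub>R q + c *\<^sub>R r + a *\<^sub>R p" "w = c *\<^sub>R r + a *\<^sub>R p + b *\<^sub>R q"
      unfolding w by (simp_all add: algebra_simps)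
    have sum': "b + c + a = 1 - k" "c + a + b = 1 - k"
      using sum by simp_all
    \<comment> \<open>Up to cyclic rotation: no negative coordinate, exactly one, or at least
      two.\<close>
    consider "a > 0" "b > 0" "c > 0" | "a > 0" "b > 0" "c < 0" | "b > 0" "c > 0" "a < 0"
      | "c > 0" "a > 0" "b < 0" | "a < 0" "b < 0" | "b < 0" "c < 0" | "c < 0" "a < 0"
      using nz by argo
    then show False
    proof cases
      case 1
      then show False
        using no_three_homothetic_positive[of p q r k w a b c] C k(1) sum w nc by blast
    next
      case 2
      then show False
        using no_three_homothetic_one_negative[of p q r k w a b c] C k(1) sum w nc by blast
    next
      case 3
      then show False
        using no_three_homothetic_one_negative[of q r p k w b c a] C k(1) sum' w' rot by blast
    next
      case 4
      then show False
        using no_three_homothetic_one_negative[of r p q k w c a b] C k(1) sum' w' rot by blast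
    next
      case 5
      then show False
        using no_three_homothetic_two_negative[of p q r k w a b c] C k sum w nc by blast
    next
      case 6
      then show False
        using no_three_homothetic_two_negative[of q r p k w b c a] C k sum' w' rot by blast
    next
      case 7
      then show False
        using no_three_homothetic_two_negative[of r p q k w c a b] C k sum' w' rot by blast
    qed
  qed
  then show ?thesis
  proof (elim disjE)
    assume "a = 0"
    then show ?thesis
      using alignedI[of w b q c r k] w sum by simp
  next
    assume "b = 0"
    then show ?thesis
      using alignedI[of w a p c r k] w sum by simp
  next
    assume "c = 0"
    then show ?thesis
      using alignedI[of w a p b q k] w sum by simp
  qed
qed

section \<open>Homotheties and five points in general position\<close>

definition general_position :: "(real^2) set \<Rightarrow> bool" where
  "general_position X \<longleftrightarrow>
     (\<forall>x\<in>X. \<forall>y\<in>X. \<forall>z\<in>X. x \<noteq> y \<and> y \<noteq> z \<and> x \<noteq> z \<longrightarrow> orient x y z \<noteq> 0)"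

text \<open>The vector \<open>(k - 1) x + w\<close> is the displacement of \<open>x\<close> under
  the homothety. If it is nonzero, it spans a single line through \<open>x\<close>, on which both
  partners \<open>y\<close> and \<open>z\<close> must lie.\<close>

lemma aligned_unique:
  assumes "aligned k w x y" "aligned k w x z" "(k - 1) *\<^sub>R x + w \<noteq> 0"
  shows "orient x y z = 0"
proof -
  obtain s t where s: "(k - 1) *\<^sub>R x + w = s *\<^sub>R (y - x)" and t: "(k - 1) *\<^sub>R x + w = t *\<^sub>R (z - x)"
    using assms unfolding aligned_def by blast
  have "s * t * orient x y z = det2 (s *\<^sub>R (y - x)) (t *\<^sub>R (z - x))"
    by (simp add: orient_def det2_simps algebra_simps)
  also have "\<dots> = 0"
    using s t by (metis det2_self)
  finally show ?thesis
    using assms(3) s t by auto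
qed

text \<open>The booleans are the edges of a graph on five vertices in which every triple contains an
  edge, but no two edges share a vertex. Such a matching has at most two edges, so a free vertex
  together with one end of each edge would be a triple without edges.\<close>

lemma matching_on_five_vertices:
  fixes ab :: bool
  assumes "ab \<or> bc \<or> ac" "ab \<or> bd \<or> ad" "ab \<or> be \<or> ae" "ac \<or> cd \<or> ad" "ac \<or> ce \<or> ae"
    "ad \<or> de \<or> ae" "bc \<or> cd \<or> bd" "bc \<or> ce \<or> be" "bd \<or> de \<or> be" "cd \<or> de \<or> ce"
    and "\<not> (ab \<and> ac)" "\<not> (ab \<and> ad)" "\<not> (ab \<and> ae)" "\<not> (ac \<and> ad)" "\<not> (ac \<and> ae)" "\<not> (ad \<and> ae)"
    and "\<not> (ab \<and> bc)" "\<not> (ab \<and> bd)" "\<not> (ab \<and> be)" "\<not> (bc \<and> bd)" "\<not> (bc \<and> be)" "\<not> (bd \<and> be)"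
    and "\<not> (ac \<and> bc)" "\<not> (ac \<and> cd)" "\<not> (ac \<and> ce)" "\<not> (bc \<and> cd)" "\<not> (bc \<and> ce)" "\<not> (cd \<and> ce)"
    and "\<not> (ad \<and> bd)" "\<not> (ad \<and> cd)" "\<not> (ad \<and> de)" "\<not> (bd \<and> cd)" "\<not> (bd \<and> de)" "\<not> (cd \<and> de)"
  shows False
  using assms by (cases ab; cases ac; cases ad; cases ae) auto

context convex_body
begin

text \<open>Every triple contains an aligned pair. If no point is fixed, each point has at most one
  partner, and the aligned pairs form an impossible matching. A fixed point \<open>z\<close> is
  aligned with all others, which uses up their only partner; three of the remaining points then
  contain no aligned pair.\<close>

lemma five_points_homothety_trivial:
  assumes X: "X \<subseteq> C" "\<And>x. x \<in> X \<Longrightarrow> k *\<^sub>R x + w \<in> C"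
    and k: "k > 0" "k \<le> 1" and card: "card X = 5" and gp: "general_position X"
  shows "k = 1 \<and> w = 0"
proof (rule ccontr)
  assume nt: "\<not> ?thesis"
  let ?d = "\<lambda>x. (k - 1) *\<^sub>R x + w"
  have tri: "aligned k w x y \<or> aligned k w y z \<or> aligned k w x z"
    if "x \<in> X" "y \<in> X" "z \<in> X" "x \<noteq> y" "y \<noteq> z" "x \<noteq> z" for x y z
    using that X k gp homothetic_triangles_aligned[of x y z k w]
    unfolding general_position_def by blast
  have uniq: "\<not> (aligned k w x y \<and> aligned k w x z)"
    if "x \<in> X" "y \<in> X" "z \<in> X" "x \<noteq> y" "y \<noteq> z" "x \<noteq> z" "?d x \<noteq> 0" for x y z
    using that gp aligned_unique[of k w x y z] unfolding general_position_def by blast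
  have inX: "finite X"
    using card by (simp add: card_ge_0_finite)
  show False
  proof (cases "\<exists>z\<in>X. ?d z = 0")
    case True
    then obtain z where z: "z \<in> X" "?d z = 0"
      by blast
    have d: "?d x = (k - 1) *\<^sub>R (x - z)" for x
    proof -
      have "?d x = ?d x - ?d z"
        using z(2) by simp
      then show ?thesis
        by (simp add: algebra_simps)
    qed
    have "k \<noteq> 1"
      using nt z(2) by auto
    have star: "aligned k w x z" for x
      unfolding aligned_def using z(2) d[of x]
      by (intro exI[of _ "1 - k"] exI[of _ 0]) (simp add: algebra_simps)
    have "card (X - {z}) = 4"
      using z card inX by simp
    then obtain Y where "Y \<subseteq> X - {z}" "card Y = 3"
      using obtain_subset_with_card_n[of 3 "X - {z}"] by auto
    then obtain a b c where abc: "{a, b, c} \<subseteq> X - {z}" "a \<noteq> b" "b \<noteq> c" "a \<noteq> c"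
      using card_3_iff[of Y] by auto
    have "?d x \<noteq> 0" if "x \<in> X - {z}" for x
      using that d[of x] \<open>k \<noteq> 1\<close> by simp
    then have "\<not> aligned k w x y" if "x \<in> X - {z}" "y \<in> X - {z}" "x \<noteq> y" for x y
      using that uniq[of x y z] z star by blast
    then show False
      using tri[of a b c] abc by blast
  next
    case False
    obtain a Y where a: "X = insert a Y" "a \<notin> Y" "card Y = 4"
      using card card_eq_SucD[of X 4] by auto
    obtain b c d e where bcde: "Y = {b, c, d, e}" "distinct [b, c, d, e]"
    proof -
      obtain b Z where b: "Y = insert b Z" "b \<notin> Z" "card Z = 3"
        using a(3) card_eq_SucD[of Y 3] by auto
      obtain c d e where "Z = {c, d, e}" "c \<noteq> d" "d \<noteq> e" "c \<noteq> e"
        using b(3) card_3_iff by metis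
      then show ?thesis
        using that b by simp
    qed
    have inX: "a \<in> X" "b \<in> X" "c \<in> X" "d \<in> X" "e \<in> X"
      using a bcde by auto
    have ne: "a \<noteq> b" "a \<noteq> c" "a \<noteq> d" "a \<noteq> e" "b \<noteq> c" "b \<noteq> d" "b \<noteq> e" "c \<noteq> d" "c \<noteq> e" "d \<noteq> e"
      using a bcde by auto
    have nz: "?d a \<noteq> 0" "?d b \<noteq> 0" "?d c \<noteq> 0" "?d d \<noteq> 0" "?d e \<noteq> 0"
      using False inX by blast+
    have uniq': "\<not> (aligned k w y x \<and> aligned k w x z)" "\<not> (aligned k w y x \<and> aligned k w z x)"
      if "x \<in> X" "y \<in> X" "z \<in> X" "x \<noteq> y" "y \<noteq> z" "x \<noteq> z" "?d x \<noteq> 0" for x y z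
      using uniq[OF that] aligned_commute by blast+
    show False
      by (rule matching_on_five_vertices[of "aligned k w a b" "aligned k w b c" "aligned k w a c"
            "aligned k w b d" "aligned k w a d" "aligned k w b e" "aligned k w a e"
            "aligned k w c d" "aligned k w c e" "aligned k w d e"];
          rule tri uniq uniq'; simp add: inX ne ne[symmetric] nz)
  qed
qed

end

section \<open>Common points of two homothets of a curve\<close>

lemma translates_subset_homothets: "translates C \<subseteq> homothets C"
  unfolding translates_def homothets_def by (force intro: exI[of _ 1])

lemma orient_affine: "orient (r *\<^sub>R x + v) (r *\<^sub>R y + v) (r *\<^sub>R z + v) = r\<^sup>2 * orient x y z"
  by (simp add: orient_def det2_def power2_eq_square algebra_simps)

lemma mem_homothet_iff:
  fixes C :: "'a::real_vector set"
  assumes "r > 0"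
  shows "x \<in> (\<lambda>x. r *\<^sub>R x + v) ` C \<longleftrightarrow> (1 / r) *\<^sub>R x - (1 / r) *\<^sub>R v \<in> C"
proof -
  have "x = r *\<^sub>R y + v \<longleftrightarrow> y = (1 / r) *\<^sub>R x - (1 / r) *\<^sub>R v" for y
  proof
    assume "x = r *\<^sub>R y + v"
    then show "y = (1 / r) *\<^sub>R x - (1 / r) *\<^sub>R v"
      using assms by (simp add: scaleR_add_right)
  next
    assume "y = (1 / r) *\<^sub>R x - (1 / r) *\<^sub>R v"
    then show "x = r *\<^sub>R y + v"
      using assms by (simp add: scaleR_diff_right)
  qed
  then show ?thesis
    by (simp add: image_iff)
qed

lemma mem_translate_iff: "x \<in> (\<lambda>x. x + v) ` C \<longleftrightarrow> x - v \<in> (C :: 'a::group_add set)"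
  by (metis (no_types, lifting) add_diff_cancel diff_add_cancel image_iff)

text \<open>A common point of both copies has two preimages in \<open>C\<close>, and a fixed
  homothety takes the first to the second. Ordering the copies by size makes its ratio at most
  1.\<close>

lemma homothets_relative:
  assumes "T \<in> homothets C" "T' \<in> homothets C" "T \<noteq> T'"
  obtains r v k w where "r > 0" "0 < k" "k \<le> 1" "k \<noteq> 1 \<or> w \<noteq> 0"
    "\<And>x. x \<in> T \<inter> T' \<Longrightarrow> r *\<^sub>R x + v \<in> C \<and> k *\<^sub>R (r *\<^sub>R x + v) + w \<in> C"
proof -
  note result = that
  have main: thesis
    if T: "T1 = (\<lambda>x. r1 *\<^sub>R x + v1) ` C" "T2 = (\<lambda>x. r2 *\<^sub>R x + v2) ` C"
      and r: "0 < r1" "r1 \<le> r2" and ne: "T1 \<noteq> T2" and sub: "T \<inter> T' \<subseteq> T1 \<inter> T2" for T1 T2 r1 r2 v1 v2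
  proof (rule result[of "1 / r1" "r1 / r2" "(1 / r2) *\<^sub>R (v1 - v2)" "- ((1 / r1) *\<^sub>R v1)"])
    show "r1 / r2 \<noteq> 1 \<or> (1 / r2) *\<^sub>R (v1 - v2) \<noteq> 0"
      using ne r T by auto
    fix x assume "x \<in> T \<inter> T'"
    then have "x \<in> T1" "x \<in> T2"
      using sub by auto
    then have "(1 / r1) *\<^sub>R x - (1 / r1) *\<^sub>R v1 \<in> C" "(1 / r2) *\<^sub>R x - (1 / r2) *\<^sub>R v2 \<in> C"
      using T r mem_homothet_iff[of r1 x v1 C] mem_homothet_iff[of r2 x v2 C] by auto
    moreover have "(r1 / r2) *\<^sub>R ((1 / r1) *\<^sub>R x + - ((1 / r1) *\<^sub>R v1)) + (1 / r2) *\<^sub>R (v1 - v2)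
        = (1 / r2) *\<^sub>R x - (1 / r2) *\<^sub>R v2"
      using r by (simp add: algebra_simps)
    ultimately show "(1 / r1) *\<^sub>R x + - ((1 / r1) *\<^sub>R v1) \<in> C \<and>
        (r1 / r2) *\<^sub>R ((1 / r1) *\<^sub>R x + - ((1 / r1) *\<^sub>R v1)) + (1 / r2) *\<^sub>R (v1 - v2) \<in> C"
      by (simp only:) simp
  qed (use r in auto)
  obtain r1 v1 r2 v2 where "T = (\<lambda>x. r1 *\<^sub>R x + v1) ` C" "T' = (\<lambda>x. r2 *\<^sub>R x + v2) ` C" "r1 > 0" "r2 > 0"
    using assms unfolding homothets_def by blast
  note T = this
  show thesis
  proof (cases "r1 \<le> r2")
    case True
    then show thesis
      using main[OF T(1,2,3)] assms(3) by blast
  next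
    case False
    then show thesis
      using main[OF T(2,1,4)] assms(3) by fastforce
  qed
qed

lemma frontier_homothet:
  fixes A :: "'a::euclidean_space set"
  assumes "r > 0"
  shows "(\<lambda>x. r *\<^sub>R x + v) ` frontier A = frontier ((\<lambda>x. r *\<^sub>R x + v) ` A)"
proof -
  have lin: "linear ((*\<^sub>R) r :: 'a \<Rightarrow> 'a)" and inj: "inj ((*\<^sub>R) r :: 'a \<Rightarrow> 'a)"
    using assms by (simp_all add: inj_on_def)
  have "(\<lambda>x. r *\<^sub>R x + v) ` X = (+) v ` ((*\<^sub>R) r ` X)" for X :: "'a set"
    by (simp add: image_image add.commute)
  moreover have "(*\<^sub>R) r ` frontier A = frontier ((*\<^sub>R) r ` A)"
    unfolding frontier_def image_set_diff[OF inj] closure_injective_linear_image[OF lin inj]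
      interior_injective_linear_image[OF lin inj] by simp
  ultimately show ?thesis
    by (simp add: frontier_translation)
qed

lemma (in convex_body) homothet_frontier:
  assumes "T \<in> homothets C"
  obtains B where "convex_body B" "T = frontier B"
proof -
  obtain r v where r: "r > 0" and T: "T = (\<lambda>x. r *\<^sub>R x + v) ` C"
    using assms unfolding homothets_def by blast
  have eq: "(\<lambda>x. r *\<^sub>R x + v) ` A = (+) v ` ((*\<^sub>R) r ` A)"
    by (simp add: image_image add.commute)
  have "convex_body ((\<lambda>x. r *\<^sub>R x + v) ` A)"
    unfolding eq by unfold_locales (simp_all add: closed convex closed_scaling closed_translation
        convex_scaling convex_translation)
  then show ?thesis
    using that frontier_homothet[OF r] T by metis
qed

lemma (in convex_body) homothets_five_points:
  assumes "T \<in> homothets C" "T' \<in> homothets C" "X \<subseteq> T" "X \<subseteq> T'" "card X = 5" "general_position X"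
  shows "T = T'"
proof (rule ccontr)
  assume "T \<noteq> T'"
  then obtain r v k w where *: "r > 0" "0 < k" "k \<le> 1" "k \<noteq> 1 \<or> w \<noteq> 0"
    "\<And>x. x \<in> T \<inter> T' \<Longrightarrow> r *\<^sub>R x + v \<in> C \<and> k *\<^sub>R (r *\<^sub>R x + v) + w \<in> C"
    using homothets_relative[OF assms(1,2)] by metis
  let ?f = "\<lambda>x. r *\<^sub>R x + v"
  have "inj_on ?f X"
    using *(1) by (simp add: inj_on_def)
  then have "card (?f ` X) = 5"
    using assms(5) by (simp add: card_image)
  moreover have "general_position (?f ` X)"
    using assms(6) *(1) unfolding general_position_def by (simp add: orient_affine)
  ultimately show False
    using five_points_homothety_trivial[of "?f ` X" k w] * assms(3,4) by blast
qed

text \<open>Three points of the curve are not collinear, so two of them, \<open>x\<close> and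
  \<open>y\<close>, are aligned. Their images lie on the line through \<open>x\<close> and
  \<open>y\<close> and on the curve, hence are \<open>x\<close> or \<open>y\<close>. With ratio
  \<open>k\<close> between 0 and 1 this forces the identity.\<close>

lemma strict_homothets_three_points:
  assumes "convex_body A" and strict: "\<not> (\<exists>a b. a \<noteq> b \<and> closed_segment a b \<subseteq> frontier A)"
    and T: "T \<in> homothets (frontier A)" "T' \<in> homothets (frontier A)"
      "X \<subseteq> T" "X \<subseteq> T'" and card: "card X = 3"
  shows "T = T'"
proof (rule ccontr)
  interpret convex_body A by fact
  assume "T \<noteq> T'"
  then obtain r v k w where *: "r > 0" "0 < k" "k \<le> 1" "k \<noteq> 1 \<or> w \<noteq> 0"
    "\<And>x. x \<in> T \<inter> T' \<Longrightarrow> r *\<^sub>R x + v \<in> C \<and> k *\<^sub>R (r *\<^sub>R x + v) + w \<in> C"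
    using homothets_relative[OF T(1,2)] by metis
  have nc: "orient x y z \<noteq> 0" if "x \<in> C" "y \<in> C" "z \<in> C" "x \<noteq> y" "y \<noteq> z" "x \<noteq> z" for x y z
    using segment_if_collinear[of x y z] that strict by metis
  have not_aligned: False
    if xy: "x \<in> C" "y \<in> C" "k *\<^sub>R x + w \<in> C" "k *\<^sub>R y + w \<in> C" "x \<noteq> y" and "aligned k w x y" for x y
  proof -
    obtain s t where s: "(k - 1) *\<^sub>R x + w = s *\<^sub>R (y - x)" and t: "(k - 1) *\<^sub>R y + w = t *\<^sub>R (x - y)"
      using \<open>aligned k w x y\<close> unfolding aligned_def by blast
    have "k *\<^sub>R x + w = x + ((k - 1) *\<^sub>R x + w)" "k *\<^sub>R y + w = y + ((k - 1) *\<^sub>R y + w)"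
      by (simp_all add: algebra_simps)
    then have x': "k *\<^sub>R x + w = x + s *\<^sub>R (y - x)" and y': "k *\<^sub>R y + w = y + t *\<^sub>R (x - y)"
      unfolding s t by simp_all
    have "s \<in> {0, 1}"
    proof (rule ccontr)
      assume "s \<notin> {0, 1}"
      moreover have "x + s *\<^sub>R (y - x) - y = (s - 1) *\<^sub>R (y - x)"
        by (simp add: algebra_simps)
      ultimately have "x + s *\<^sub>R (y - x) \<noteq> x" "y \<noteq> x + s *\<^sub>R (y - x)"
        using xy(5) by auto
      moreover have "orient x y (x + s *\<^sub>R (y - x)) = 0"
        by (simp add: orient_def det2_simps)
      ultimately show False
        using nc[of x y "x + s *\<^sub>R (y - x)"] xy x' by auto
    qed
    moreover have "t \<in> {0, 1}"
    proof (rule ccontr)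
      assume "t \<notin> {0, 1}"
      moreover have "y + t *\<^sub>R (x - y) - x = (t - 1) *\<^sub>R (x - y)"
        by (simp add: algebra_simps)
      ultimately have "y + t *\<^sub>R (x - y) \<noteq> y" "x \<noteq> y + t *\<^sub>R (x - y)"
        using xy(5) by auto
      moreover have "orient y x (y + t *\<^sub>R (x - y)) = 0"
        by (simp add: orient_def det2_simps)
      ultimately show False
        using nc[of y x "y + t *\<^sub>R (x - y)"] xy y' by auto
    qed
    moreover have "s + t = 1 - k"
    proof -
      have "(k - 1) *\<^sub>R (x - y) = ((k - 1) *\<^sub>R x + w) - ((k - 1) *\<^sub>R y + w)"
        by (simp add: algebra_simps)
      also have "\<dots> = (- s - t) *\<^sub>R (x - y)"
        unfolding s t by (simp add: algebra_simps)
      finally show ?thesis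
        using xy(5) by simp
    qed
    ultimately have "s = 0" "k = 1"
      using *(2,3) by auto
    then show False
      using s *(4) by simp
  qed
  obtain x y z where X: "X = {x, y, z}" "x \<noteq> y" "y \<noteq> z" "x \<noteq> z"
    using card card_3_iff by metis
  let ?f = "\<lambda>x. r *\<^sub>R x + v"
  have f: "?f x \<in> C \<and> k *\<^sub>R ?f x + w \<in> C" "?f y \<in> C \<and> k *\<^sub>R ?f y + w \<in> C" "?f z \<in> C \<and> k *\<^sub>R ?f z + w \<in> C"
    using *(5) X T by auto
  have ne: "?f x \<noteq> ?f y" "?f y \<noteq> ?f z" "?f x \<noteq> ?f z"
    using X *(1) by auto
  show False
    using homothetic_triangles_aligned[of "?f x" "?f y" "?f z" k w] f ne nc *(2,3) not_aligned by blast
qed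

subsection \<open>Containment properties\<close>

text \<open>The curve through \<open>X\<close> is unique, so testing \<open>X\<close> with one
  further point of \<open>S\<close> always yields the same curve.\<close>

lemma covered_if_determined:
  assumes cov: "\<And>S0. S0 \<subseteq> S \<Longrightarrow> finite S0 \<Longrightarrow> card S0 \<le> Suc n \<Longrightarrow> \<exists>T\<in>F. S0 \<subseteq> T"
    and X: "X \<subseteq> S" "finite X" "card X \<le> n"
    and uniq: "\<And>T T'. T \<in> F \<Longrightarrow> T' \<in> F \<Longrightarrow> X \<subseteq> T \<Longrightarrow> X \<subseteq> T' \<Longrightarrow> T = T'"
  shows "\<exists>T\<in>F. S \<subseteq> T"
proof -
  obtain T where T: "T \<in> F" "X \<subseteq> T"
    using cov[of X] X by auto
  have "s \<in> T" if "s \<in> S" for s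
  proof -
    have "card (insert s X) \<le> Suc n" "insert s X \<subseteq> S" "finite (insert s X)"
      using X that by (simp_all add: card_insert_if)
    then obtain T' where "T' \<in> F" "insert s X \<subseteq> T'"
      using cov by blast
    then show ?thesis
      using uniq[of T T'] T by auto
  qed
  then show ?thesis
    using T by auto
qed

lemma containment_property_if_determined:
  assumes "\<And>X T T'. card X = n \<Longrightarrow> finite X \<Longrightarrow> T \<in> F \<Longrightarrow> T' \<in> F \<Longrightarrow> X \<subseteq> T \<Longrightarrow> X \<subseteq> T' \<Longrightarrow> T = T'"
  shows "containment_property P F (Suc n)"
  unfolding containment_property_def
proof (intro allI impI)
  fix S
  assume cov: "\<forall>S0. S0 \<subseteq> S \<and> finite S0 \<and> card S0 \<le> Suc n \<longrightarrow> (\<exists>T\<in>F. S0 \<subseteq> T)"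
  show "\<exists>T\<in>F. S \<subseteq> T"
  proof (cases "finite S \<and> card S \<le> n")
    case True
    then show ?thesis
      using cov by auto
  next
    case False
    then obtain X where "X \<subseteq> S" "finite X" "card X = n"
      by (meson infinite_arbitrarily_large linear obtain_subset_with_card_n)
    then show ?thesis
      using covered_if_determined[of S n F X] cov assms by blast
  qed
qed

lemma containment_order_le:
  "containment_property P F m \<Longrightarrow> containment_order P F \<le> enat m"
  unfolding containment_order_def by (simp add: Inf_lower)

lemma containment_property_mono:
  "containment_property P F m \<Longrightarrow> m \<le> n \<Longrightarrow> containment_property P F n"
  unfolding containment_property_def by (meson le_trans)

lemma containment_order_eqI:
  assumes "containment_property P F (Suc m)" "\<not> containment_property P F m"
  shows "containment_order P F = enat (Suc m)"
proof (rule antisym[OF containment_order_le[OF assms(1)]])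
  have "enat (Suc m) \<le> x" if "x \<in> enat ` {m. containment_property P F m}" for x
    using that assms(2) containment_property_mono[of P F _ m] by (force simp: not_less_eq_eq)
  then show "enat (Suc m) \<le> containment_order P F"
    unfolding containment_order_def by (rule Inf_greatest)
qed

section \<open>Convex quadrangles\<close>

lemma orient_open_segment_pos:
  assumes "x \<in> open_segment p q" "orient p r s \<ge> 0" "orient q r s \<ge> 0" "orient p r s + orient q r s > 0"
  shows "orient x r s > 0"
proof -
  obtain t where t: "0 < t" "t < 1" "x = (1 - t) *\<^sub>R p + t *\<^sub>R q"
    using assms(1) by (auto simp: in_segment)
  have "orient x r s = (1 - t) * orient p r s + t * orient q r s"
    unfolding t(3) by (rule orient_convex_left)
  moreover have "(1 - t) * orient p r s \<ge> 0" "t * orient q r s \<ge> 0"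
    using t assms by simp_all
  moreover have "(1 - t) * orient p r s > 0 \<or> t * orient q r s > 0"
    using t assms by (smt (verit) mult_pos_pos)
  ultimately show ?thesis
    by linarith
qed

text \<open>A strictly convex quadrangle, its vertices in counterclockwise order.\<close>

definition quad :: "real^2 \<Rightarrow> real^2 \<Rightarrow> real^2 \<Rightarrow> real^2 \<Rightarrow> bool" where
  "quad a b c d \<longleftrightarrow> orient a b c > 0 \<and> orient b c d > 0 \<and> orient c d a > 0 \<and> orient d a b > 0"

lemma quad_rotate: "quad a b c d \<Longrightarrow> quad b c d a"
  unfolding quad_def by blast

lemma orient_pos_perms:
  assumes "orient x y z > 0"
  shows "orient x y z \<noteq> 0" "orient y z x \<noteq> 0" "orient z x y \<noteq> 0"
    "orient y x z \<noteq> 0" "orient x z y \<noteq> 0" "orient z y x \<noteq> 0" "x \<noteq> y" "y \<noteq> z" "x \<noteq> z"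
  using assms orient_rotate[of x y z] orient_rotate[of z x y] orient_swap[of y x z] orient_swap[of x z y]
    orient_swap[of z y x] by auto

text \<open>The points \<open>a\<close>, \<open>e\<close>, \<open>f\<close>, \<open>g\<close>,
  \<open>d\<close> form a convex pentagon. An orientation is affine in each argument, so its sign at
  an inner point of a side follows from the signs at the two ends; the vertices are replaced one at
  a time.\<close>

lemma general_position_three_sides:
  assumes "quad a b c d" and e: "e \<in> open_segment a b" "f \<in> open_segment b c" "g \<in> open_segment c d"
  shows "general_position {a, e, f, g, d}" "card {a, e, f, g, d} = 5"
proof -
  note pos = orient_open_segment_pos
  have rot: "orient z x y > 0" if "orient x y z > 0" for x y z
    using that orient_rotate[of z x y] orient_rotate[of y z x] by simp
  have abc: "orient a b c > 0" "orient b c a > 0" "orient c a b > 0"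
    and bcd: "orient b c d > 0" "orient c d b > 0" "orient d b c > 0"
    and cda: "orient c d a > 0" "orient d a c > 0" "orient a c d > 0"
    and dab: "orient d a b > 0" "orient a b d > 0" "orient b d a > 0"
    using assms(1) orient_rotate unfolding quad_def by metis+
  have bcg: "orient g b c > 0"
    by (rule pos[OF e(3)]) (use bcd in auto)
  have acg: "orient g a c > 0"
    by (rule pos[OF e(3)]) (use cda in auto)
  have abg: "orient g a b > 0"
    by (rule pos[OF e(3)]) (use abc dab in auto)
  have abf: "orient f a b > 0"
    by (rule pos[OF e(2)]) (use abc in auto)
  have afg: "orient f g a > 0"
    by (rule pos[OF e(2)]) (use abg[THEN rot] acg[THEN rot] in auto)
  have bfg: "orient f g b > 0"
    by (rule pos[OF e(2)]) (use bcg[THEN rot] in auto)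
  have aef: "orient e f a > 0"
    by (rule pos[OF e(1)]) (use abf[THEN rot] in auto)
  have aeg: "orient e g a > 0"
    by (rule pos[OF e(1)]) (use abg[THEN rot] in auto)
  have aed: "orient e d a > 0"
    by (rule pos[OF e(1)]) (use dab in auto)
  have afd: "orient f d a > 0"
    by (rule pos[OF e(2)]) (use cda dab in auto)
  have agd: "orient g d a > 0"
    by (rule pos[OF e(3)]) (use cda in auto)
  have bfd: "orient f d b > 0"
    by (rule pos[OF e(2)]) (use bcd in auto)
  have bgd: "orient g d b > 0"
    by (rule pos[OF e(3)]) (use bcd in auto)
  have efg: "orient e f g > 0"
    by (rule pos[OF e(1)]) (use afg[THEN rot] bfg[THEN rot] in auto)
  have efd: "orient e f d > 0"
    by (rule pos[OF e(1)]) (use afd[THEN rot] bfd[THEN rot] in auto)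
  have egd: "orient e g d > 0"
    by (rule pos[OF e(1)]) (use agd[THEN rot] bgd[THEN rot] in auto)
  have fgd: "orient f g d > 0"
  proof -
    have "orient c g d = 0"
    proof -
      obtain t where g: "g = (1 - t) *\<^sub>R c + t *\<^sub>R d"
        using e(3) by (auto simp: in_segment)
      show ?thesis
        unfolding g by (simp add: orient_def det2_def algebra_simps)
    qed
    then show ?thesis
      using pos[OF e(2), of g d] bgd[THEN rot] by simp
  qed
  note perms = afg aef aeg aed afd agd efg efd egd fgd
  note all = perms[THEN orient_pos_perms(1)] perms[THEN orient_pos_perms(2)] perms[THEN orient_pos_perms(3)]
    perms[THEN orient_pos_perms(4)] perms[THEN orient_pos_perms(5)] perms[THEN orient_pos_perms(6)]
  note ne = perms[THEN orient_pos_perms(7)] perms[THEN orient_pos_perms(8)] perms[THEN orient_pos_perms(9)]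
  show "card {a, e, f, g, d} = 5"
    using ne by auto
  show "general_position {a, e, f, g, d}"
    unfolding general_position_def
    by (intro ballI impI; elim insertE emptyE; simp add: all)
qed

text \<open>In a Radon partition of the four points no part is a single point, so it consists of two
  pairs, the diagonals, which cross at \<open>x\<close>. Expressing the areas at \<open>x\<close>
  along either diagonal shows that all four orientations have the same sign; exchanging
  \<open>b\<close> and \<open>d\<close> makes it positive.\<close>

lemma four_points_quad:
  assumes card: "card V = 4" and gp: "general_position V"
    and ext: "\<And>v. v \<in> V \<Longrightarrow> v \<notin> convex hull (V - {v})"
  obtains a b c d where "V = {a, b, c, d}" "quad a b c d"
    "closed_segment a c \<inter> open_segment b d \<noteq> {}" "closed_segment b d \<inter> open_segment a c \<noteq> {}"
proof -
  have fin: "finite V"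
    using card by (simp add: card_ge_0_finite)
  have "affine_dependent V"
    using affine_dependent_biggerset[OF fin] card by simp
  then obtain M P where MP: "M \<inter> P = {}" "M \<union> P = V" "convex hull M \<inter> convex hull P \<noteq> {}"
    using Radon_partition[OF fin] by blast
  have finMP: "finite M" "finite P"
    using MP fin by auto
  have cardMP: "card M + card P = 4"
    using MP card finMP card_Un_disjoint by metis
  have not1: "card M \<noteq> 1" if "M \<inter> P = {}" "M \<union> P = V" "convex hull M \<inter> convex hull P \<noteq> {}" for M P
  proof
    assume "card M = 1"
    then obtain m where "M = {m}"
      using card_1_singletonE by blast
    moreover from this have "P = V - {m}"
      using that by blast
    ultimately show False
      using that ext[of m] by auto
  qed
  have "card M \<noteq> 0" "card P \<noteq> 0"
    using MP finMP by auto
  moreover have "card M \<noteq> 1" "card P \<noteq> 1"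
    using not1[of M P] not1[of P M] MP by (simp_all add: Int_commute Un_commute)
  ultimately have "card M = 2" "card P = 2"
    using cardMP by linarith+
  then obtain a c b d where M: "M = {a, c}" "a \<noteq> c" and P: "P = {b, d}" "b \<noteq> d"
    by (meson card_2_iff)
  obtain x where x: "x \<in> closed_segment a c" "x \<in> closed_segment b d"
    using MP(3) M P by (auto simp: segment_convex_hull)
  have V: "V = {a, b, c, d}"
    using MP M P by auto
  have dist: "a \<noteq> b" "b \<noteq> c" "c \<noteq> d" "a \<noteq> d"
    using MP M P by auto
  have "x \<noteq> v" if "v \<in> V" for v
  proof
    assume "x = v"
    then have "v \<in> convex hull (V - {v})"
      using that x M P dist hull_mono[of "{a, c}" "V - {v}" convex] hull_mono[of "{b, d}" "V - {v}" convex]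
      unfolding V segment_convex_hull by auto
    then show False
      using ext that by blast
  qed
  then have xo: "x \<in> open_segment a c" "x \<in> open_segment b d"
    using x V by (auto simp: open_segment_def)
  obtain s where s: "0 < s" "s < 1" "x = (1 - s) *\<^sub>R a + s *\<^sub>R c"
    using xo(1) by (auto simp: in_segment)
  obtain t where t: "0 < t" "t < 1" "x = (1 - t) *\<^sub>R b + t *\<^sub>R d"
    using xo(2) by (auto simp: in_segment)
  have "s * orient a b c = orient x a b" "(1 - s) * orient a b c = orient x b c"
      "(1 - s) * orient c d a = orient x c d"
    unfolding s(3) by (simp_all add: orient_def det2_def algebra_simps)
  moreover have "t * orient d a b = orient x a b" "t * orient b c d = orient x b c"
      "(1 - t) * orient b c d = orient x c d"
    unfolding t(3) by (simp_all add: orient_def det2_def algebra_simps)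
  ultimately have eqs: "s * orient a b c = t * orient d a b" "(1 - s) * orient a b c = t * orient b c d"
      "(1 - s) * orient c d a = (1 - t) * orient b c d"
    by simp_all
  have iff: "0 < u * y \<longleftrightarrow> 0 < y" if "0 < u" for u y :: real
    using that by (simp add: zero_less_mult_iff)
  have iff': "u * y < 0 \<longleftrightarrow> y < 0" if "0 < u" for u y :: real
    using that by (simp add: mult_less_0_iff)
  have nz: "orient a b c \<noteq> 0"
    using gp dist M P V unfolding general_position_def by blast
  have "quad a b c d \<or> quad a d c b"
  proof (cases "orient a b c > 0")
    case True
    then have "orient d a b > 0" "orient b c d > 0"
      using eqs iff[of s] iff[of t] iff[of "1 - s"] s t by (metis diff_gt_0_iff_gt)+
    moreover from this have "orient c d a > 0"
      using eqs iff[of "1 - t"] iff[of "1 - s"] s t by (metis diff_gt_0_iff_gt)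
    ultimately show ?thesis
      using True unfolding quad_def by blast
  next
    case False
    then have neg: "orient a b c < 0"
      using nz by simp
    then have "orient d a b < 0" "orient b c d < 0"
      using eqs iff'[of s] iff'[of t] iff'[of "1 - s"] s t by (metis diff_gt_0_iff_gt)+
    moreover from this have "orient c d a < 0"
      using eqs iff'[of "1 - t"] iff'[of "1 - s"] s t by (metis diff_gt_0_iff_gt)
    moreover have "orient a d c = - orient c d a" "orient d c b = - orient b c d"
      "orient c b a = - orient a b c" "orient b a d = - orient d a b"
      by (simp_all add: orient_def det2_def algebra_simps)
    ultimately show ?thesis
      using neg unfolding quad_def by simp
  qed
  then show ?thesis
  proof
    assume "quad a b c d"
    then show ?thesis
      using that[of a b c d] V x xo by blast
  next
    assume "quad a d c b"
    moreover have "V = {a, d, c, b}"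
      using V by auto
    ultimately show ?thesis
      using that[of a d c b] x xo by (auto simp: open_segment_commute closed_segment_commute)
  qed
qed

section \<open>Six test points for compact sets\<close>

lemma card_le_3_elements:
  assumes "finite W" "card W \<le> 3" "W \<noteq> {}"
  obtains a b c where "W = {a, b, c}"
proof -
  have "card W \<noteq> 0"
    using assms by simp
  then consider "card W = 1" | "card W = 2" | "card W = 3"
    using assms(2) by linarith
  then show ?thesis
  proof cases
    case 1
    then show ?thesis
      using that card_1_singletonE by (metis insert_absorb2)
  next
    case 2
    then show ?thesis
      using that by (metis card_2_iff insert_absorb2)
  next
    case 3
    then show ?thesis
      using that card_3_iff by metis
  qed
qed

lemma extreme_not_in_hull:
  assumes "v extreme_point_of K" "convex K" "V \<subseteq> K"
  shows "v \<notin> convex hull (V - {v})"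
proof -
  have "convex (K - {v})"
    using assms extreme_point_of_stillconvex by blast
  then have "convex hull (V - {v}) \<subseteq> K - {v}"
    using assms(3) by (intro hull_minimal) auto
  then show ?thesis
    by blast
qed

lemma general_position_extreme_points:
  assumes "convex K"
  shows "general_position {x. x extreme_point_of K}"
  unfolding general_position_def
proof (intro ballI impI notI)
  fix x y z
  assume V: "x \<in> {x. x extreme_point_of K}" "y \<in> {x. x extreme_point_of K}" "z \<in> {x. x extreme_point_of K}"
    and ne: "x \<noteq> y \<and> y \<noteq> z \<and> x \<noteq> z" and "orient x y z = 0"
  then have "x \<in> open_segment z y \<or> z \<in> open_segment x y \<or> y \<in> open_segment x z"
    using collinear_between by blast
  then show False
    using V unfolding extreme_point_of_def by blast
qed

text \<open>These two properties suffice for the bound on compact sets, so that translates and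
  homothets are treated at once.\<close>

locale curve_family =
  fixes F :: "(real^2) set set"
  assumes frontier: "T \<in> F \<Longrightarrow> \<exists>B. convex_body B \<and> T = frontier B"
    and five_points: "T \<in> F \<Longrightarrow> T' \<in> F \<Longrightarrow> X \<subseteq> T \<Longrightarrow> X \<subseteq> T' \<Longrightarrow> card X = 5
      \<Longrightarrow> general_position X \<Longrightarrow> T = T'"
begin

lemma segment_covered:
  assumes "T \<in> F" "p \<in> T" "q \<in> T" "e \<in> T" "e \<in> open_segment p q"
  shows "closed_segment p q \<subseteq> T"
proof -
  obtain B where "convex_body B" "T = frontier B"
    using frontier assms(1) by blast
  then show ?thesis
    using convex_body.segment_in_frontier convex_body.C_subset assms by blast
qed

lemma collinear_if_covered:
  assumes "T \<in> F" "{x, p, q, r} \<subseteq> T" "a > 0" "b > 0" "c > 0"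
    "(a + b + c) *\<^sub>R x = a *\<^sub>R p + b *\<^sub>R q + c *\<^sub>R r"
  shows "orient p q r = 0"
proof -
  obtain B where "convex_body B" "T = frontier B"
    using frontier assms(1) by blast
  then show ?thesis
    using convex_body.collinear_if_frontier_combination[of B x p q r a b c] convex_body.C_subset assms
    by blast
qed

lemma containment_property_compact: "containment_property compact F 6"
  unfolding containment_property_def
proof (intro allI impI)
  fix S :: "(real^2) set"
  assume S: "compact S" and cov: "\<forall>S0. S0 \<subseteq> S \<and> finite S0 \<and> card S0 \<le> 6 \<longrightarrow> (\<exists>T\<in>F. S0 \<subseteq> T)"
  define K where "K = convex hull S"
  define V where "V = {x. x extreme_point_of K}"
  have K: "convex K" "compact K"
    unfolding K_def using S by (simp_all add: compact_convex_hull)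
  have VS: "V \<subseteq> S"
    unfolding V_def K_def by (rule extreme_points_of_convex_hull)
  have SV: "S \<subseteq> convex hull V"
    using Krein_Milman_Minkowski[OF K(2,1)] hull_subset[of S convex] unfolding V_def K_def by simp
  have gp: "general_position V"
    unfolding V_def by (rule general_position_extreme_points[OF K(1)])
  have ext: "v \<notin> convex hull (V - {v})" if "v \<in> V" for v
    using that extreme_not_in_hull[of v K V] K(1) VS hull_subset[of S convex] unfolding V_def K_def by blast
  have five: "\<exists>T\<in>F. S \<subseteq> T" if "X \<subseteq> S" "card X = 5" "general_position X" for X
  proof (rule covered_if_determined[of S 5 F X])
    show "finite X"
      using that(2) by (simp add: card_ge_0_finite)
    show "\<And>S0. S0 \<subseteq> S \<Longrightarrow> finite S0 \<Longrightarrow> card S0 \<le> Suc 5 \<Longrightarrow> \<exists>T\<in>F. S0 \<subseteq> T"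
      using cov by simp
  qed (use that five_points in auto)
  show "\<exists>T\<in>F. S \<subseteq> T"
  proof (cases "\<exists>X\<subseteq>V. card X = 5")
    case True
    then obtain X where "X \<subseteq> V" "card X = 5"
      by blast
    then show ?thesis
      using five[of X] VS gp unfolding general_position_def by blast
  next
    case False
    then have V: "finite V" "card V \<le> 4"
      by (meson infinite_arbitrarily_large)
        (metis False linorder_not_less obtain_subset_with_card_n Suc_le_eq eval_nat_numeral(3))
    \<comment> \<open>By Caratheodory \<open>s\<close> is a combination of at most three corners. If
      they are distinct and all weights are positive, no member of \<open>F\<close> contains
      \<open>s\<close> and these corners, although at most six points are involved.\<close>
    have on_segment: "\<exists>p\<in>V. \<exists>q\<in>V. s \<in> closed_segment p q" if s: "s \<in> S" for s
    proof -
      have "s \<in> convex hull V"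
        using s SV by blast
      then obtain W where W: "finite W" "W \<subseteq> V" "card W \<le> 3" "s \<in> convex hull W"
        unfolding caratheodory[of V] by auto
      then obtain a b c where abc: "W = {a, b, c}"
        using card_le_3_elements[of W] by (metis convex_hull_empty empty_iff)
      then obtain u v w where uvw: "s = u *\<^sub>R a + v *\<^sub>R b + w *\<^sub>R c" "0 \<le> u" "0 \<le> v" "0 \<le> w" "u + v + w = 1"
        using W(4) unfolding abc convex_hull_3 by blast
      have in_V: "a \<in> V" "b \<in> V" "c \<in> V"
        using W abc by auto
      have "u = 0 \<or> v = 0 \<or> w = 0 \<or> a = b \<or> b = c \<or> a = c"
      proof (rule ccontr)
        assume nt: "\<not> ?thesis"
        have "{s, a, b, c} \<subseteq> S" "card {s, a, b, c} \<le> 6"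
          using s in_V VS by (auto simp: card_insert_if)
        then obtain T where "T \<in> F" "{s, a, b, c} \<subseteq> T"
          using cov by (meson finite.emptyI finite.insertI)
        then have "orient a b c = 0"
          using collinear_if_covered[of T s a b c u v w] uvw nt by simp
        then show False
          using gp in_V nt unfolding general_position_def by blast
      qed
      moreover have seg: "s \<in> closed_segment p q" if "s = x *\<^sub>R p + y *\<^sub>R q" "0 \<le> x" "0 \<le> y" "x + y = 1" for x y p q
        using that unfolding in_segment by (intro exI[of _ y]) auto
      ultimately show ?thesis
        using uvw in_V seg[of v b w c] seg[of u a w c] seg[of u a v b] seg[of "u + v" b w c]
          seg[of u a "v + w" c] seg[of "u + w" c v b]
        by (smt (verit) add.commute add.left_commute add_0 scaleR_add_left scaleR_zero_left)
    qed
    \<comment> \<open>The sides and diagonals with a point of \<open>S\<close> in their interior. If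
      there are few enough of them, the corners and one such point for each form the decisive test
      set.\<close>
    define D where "D = {P. P \<subseteq> V \<and> card P = 2 \<and> S \<inter> (convex hull P - P) \<noteq> {}}"
    have finD: "finite D"
      unfolding D_def using V(1) by simp
    have D_segment: "{p, q} \<in> D \<longleftrightarrow> S \<inter> open_segment p q \<noteq> {}" if "p \<in> V" "q \<in> V" "p \<noteq> q" for p q
      using that unfolding D_def open_segment_def segment_convex_hull by simp
    show ?thesis
    proof (cases "card V + card D \<le> 6")
      case True
      have "\<forall>P\<in>D. \<exists>x. x \<in> S \<inter> (convex hull P - P)"
        unfolding D_def by blast
      then obtain e where e: "\<And>P. P \<in> D \<Longrightarrow> e P \<in> S \<inter> (convex hull P - P)"
        by metis
      have "card (V \<union> e ` D) \<le> 6"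
        using card_Un_le[of V "e ` D"] card_image_le[OF finD, of e] True by linarith
      moreover have "V \<union> e ` D \<subseteq> S" "finite (V \<union> e ` D)"
        using VS e V(1) finD by auto
      ultimately obtain T where T: "T \<in> F" "V \<union> e ` D \<subseteq> T"
        using cov by blast
      have "s \<in> T" if s: "s \<in> S" for s
      proof -
        obtain p q where pq: "p \<in> V" "q \<in> V" "s \<in> closed_segment p q"
          using on_segment[OF s] by blast
        show ?thesis
        proof (cases "s = p \<or> s = q")
          case True
          then show ?thesis
            using pq T by blast
        next
          case False
          then have "s \<in> open_segment p q" "p \<noteq> q"
            using pq by (auto simp: open_segment_def)
          then have "{p, q} \<in> D"
            using D_segment pq s by blast
          then have "e {p, q} \<in> open_segment p q" "e {p, q} \<in> T"
            using e[of "{p, q}"] T unfolding open_segment_def segment_convex_hull by auto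
          then show ?thesis
            using segment_covered[of T p q "e {p, q}"] pq T by blast
        qed
      qed
      then show ?thesis
        using T by blast
    next
      case False
      \<comment> \<open>With at most three corners, corners and pairs number at most six, so exactly
        four corners remain.\<close>
      have pairs: "card D \<le> card V choose 2"
      proof -
        have "D \<subseteq> {P. P \<subseteq> V \<and> card P = 2}"
          unfolding D_def by blast
        then show ?thesis
          using n_subsets[OF V(1), of 2] card_mono[of "{P. P \<subseteq> V \<and> card P = 2}" D] V(1) by simp
      qed
      have "card V = 4"
      proof (rule ccontr)
        assume "card V \<noteq> 4"
        then consider "card V = 0" | "card V = 1" | "card V = 2" | "card V = 3"
          using V(2) by linarith
        then show False
          using pairs False by cases (simp_all add: numeral_eq_Suc)
      qed
      then obtain a b c d where abcd: "V = {a, b, c, d}" "quad a b c d"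
        "closed_segment a c \<inter> open_segment b d \<noteq> {}" "closed_segment b d \<inter> open_segment a c \<noteq> {}"
        using four_points_quad[of V] gp ext by metis
      have quads: "quad a b c d" "quad b c d a" "quad c d a b" "quad d a b c"
        using abcd(2) quad_rotate by blast+
      \<comment> \<open>A point of \<open>S\<close> inside the diagonal \<open>p r\<close> would put
        the whole diagonal into \<open>T\<close>. But the midpoint of \<open>p\<close> and the
        crossing point \<open>x\<close> is interior to the triangle \<open>p q t\<close>.\<close>
      have no_diagonal: False
        if pr: "quad p q r t" "{p, q, r, t} \<subseteq> S" "e \<in> S \<inter> open_segment p r"
          "closed_segment p r \<inter> open_segment q t \<noteq> {}" for p q r t e
      proof -
        have "{e, p, q, r, t} \<subseteq> S" "card {e, p, q, r, t} \<le> 6"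
          using pr by (auto simp: card_insert_if)
        then obtain T where T: "T \<in> F" "{e, p, q, r, t} \<subseteq> T"
          using cov by (meson finite.emptyI finite.insertI)
        obtain x where x: "x \<in> closed_segment p r" "x \<in> open_segment q t"
          using pr(4) by blast
        obtain k where k: "0 < k" "k < 1" "x = (1 - k) *\<^sub>R q + k *\<^sub>R t"
          using x(2) by (auto simp: in_segment)
        have seg: "closed_segment p r \<subseteq> T"
          using segment_covered[of T p r e] T pr(3) by blast
        have "midpoint p x \<in> closed_segment p r"
          using x(1) convex_closed_segment[of p r] midpoint_in_closed_segment[of p x]
            closed_segment_subset[of p "closed_segment p r" x] by auto
        then have "{midpoint p x, p, q, t} \<subseteq> T"
          using T seg by blast
        moreover have "(1 + (1 - k) + k) *\<^sub>R midpoint p x = 1 *\<^sub>R p + (1 - k) *\<^sub>R q + k *\<^sub>R t"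
          unfolding k(3) midpoint_def by (simp add: algebra_simps)
        ultimately have "orient p q t = 0"
          using collinear_if_covered[of T "midpoint p x" p q t 1 "1 - k" k] T k by simp
        moreover have "orient t p q = orient p q t"
          using orient_rotate by metis
        ultimately show False
          using pr(1) unfolding quad_def by simp
      qed
      have path: "\<exists>T\<in>F. S \<subseteq> T"
        if q: "quad p q r t" "{p, q, r, t} = V" and D: "{p, q} \<in> D" "{q, r} \<in> D" "{r, t} \<in> D" for p q r t
      proof -
        have "p \<noteq> q" "q \<noteq> r" "r \<noteq> t"
          using q(1) unfolding quad_def by auto
        moreover have in_V: "p \<in> V" "q \<in> V" "r \<in> V" "t \<in> V"
          using q(2) by auto
        ultimately have "S \<inter> open_segment p q \<noteq> {}" "S \<inter> open_segment q r \<noteq> {}" "S \<inter> open_segment r t \<noteq> {}"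
          using D_segment[of p q] D_segment[of q r] D_segment[of r t] D by simp_all
        then obtain e f g where e: "e \<in> S" "f \<in> S" "g \<in> S"
          and *: "e \<in> open_segment p q" "f \<in> open_segment q r" "g \<in> open_segment r t"
          by blast
        have "{p, e, f, g, t} \<subseteq> S"
          using e in_V VS by auto
        then show ?thesis
          using five[of "{p, e, f, g, t}"] general_position_three_sides[OF q(1) *] by blast
      qed
      have "\<not> card D \<le> 2"
        using False \<open>card V = 4\<close> by simp
      have ac: "{a, c} \<notin> D"
      proof
        assume "{a, c} \<in> D"
        moreover have "a \<noteq> c" "{a, b, c, d} \<subseteq> S"
          using abcd(1,2) VS unfolding quad_def by auto
        ultimately obtain e where "e \<in> S \<inter> open_segment a c"
          using D_segment[of a c] abcd(1) by auto
        then show False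
          using no_diagonal[OF quads(1) \<open>{a, b, c, d} \<subseteq> S\<close> _ abcd(3)] by blast
      qed
      have bd: "{b, d} \<notin> D"
      proof
        assume "{b, d} \<in> D"
        moreover have "b \<noteq> d" "{b, c, d, a} \<subseteq> S" "closed_segment b d \<inter> open_segment c a \<noteq> {}"
          using abcd(1,4) quads(2) VS unfolding quad_def by (auto simp: open_segment_commute)
        ultimately obtain e where "e \<in> S \<inter> open_segment b d"
          using D_segment[of b d] abcd(1) by auto
        then show False
          using no_diagonal[OF quads(2) \<open>{b, c, d, a} \<subseteq> S\<close> _ \<open>closed_segment b d \<inter> open_segment c a \<noteq> {}\<close>] by blast
      qed
      have "D \<subseteq> {{a, b}, {b, c}, {c, d}, {d, a}}"
      proof
        fix P assume "P \<in> D"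
        then obtain x y where "P = {x, y}" "x \<noteq> y" "x \<in> V" "y \<in> V"
          unfolding D_def by (auto simp: card_2_iff)
        then show "P \<in> {{a, b}, {b, c}, {c, d}, {d, a}}"
          using \<open>P \<in> D\<close> ac bd unfolding abcd(1) by (auto simp: insert_commute)
      qed
      \<comment> \<open>More than two of the four sides are in \<open>D\<close>, and any three sides
        of a quadrangle are consecutive up to rotation.\<close>
      have three: "{a, b} \<in> D \<and> {b, c} \<in> D \<and> {c, d} \<in> D \<or> {b, c} \<in> D \<and> {c, d} \<in> D \<and> {d, a} \<in> D \<or>
        {c, d} \<in> D \<and> {d, a} \<in> D \<and> {a, b} \<in> D \<or> {d, a} \<in> D \<and> {a, b} \<in> D \<and> {b, c} \<in> D"
      proof (rule ccontr)
        assume "\<not> ?thesis"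
        then have "\<exists>P Q. D \<subseteq> {P, Q}"
          using \<open>D \<subseteq> {{a, b}, {b, c}, {c, d}, {d, a}}\<close> by blast
        then obtain P Q where "D \<subseteq> {P, Q}"
          by blast
        then have "card D \<le> card {P, Q}"
          by (simp add: card_mono)
        also have "\<dots> \<le> 2"
          by (simp add: card_insert_if)
        finally show False
          using \<open>\<not> card D \<le> 2\<close> by simp
      qed
      have perms: "{b, c, d, a} = V" "{c, d, a, b} = V" "{d, a, b, c} = V"
        unfolding abcd(1) by auto
      show ?thesis
        using three path[OF quads(1)] path[OF quads(2)] path[OF quads(3)] path[OF quads(4)] abcd(1) perms
        by blast
    qed
  qed
qed

end

text \<open>The direction \<open>r\<close> is a limit of unit vectors from \<open>p\<close> towards
  points \<open>z n\<close> of \<open>X\<close> escaping to infinity. Points on the segments from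
  \<open>x\<close> to \<open>z n\<close> converge to \<open>x + t r\<close>.\<close>

lemma closed_convex_unbounded_ray:
  fixes X :: "'a::euclidean_space set"
  assumes X: "closed X" "convex X" "\<not> bounded X"
  obtains r where "r \<noteq> 0" "\<And>x t. x \<in> X \<Longrightarrow> t \<ge> 0 \<Longrightarrow> x + t *\<^sub>R r \<in> X"
proof -
  obtain p where "p \<in> X"
    using X(3) by fastforce
  have "\<exists>z\<in>X. norm (z - p) > real n + 1" for n :: nat
  proof (rule ccontr)
    assume "\<not> ?thesis"
    then have "X \<subseteq> cball p (real n + 1)"
      by (force simp: dist_norm norm_minus_commute)
    then show False
      using X(3) bounded_cball bounded_subset by blast
  qed
  then obtain z where z: "\<And>n. z n \<in> X" "\<And>n. norm (z n - p) > real n + 1"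
    by metis
  define l where "l = (\<lambda>n. norm (z n - p))"
  have l: "l n > real n + 1" for n
    using z(2) by (simp add: l_def)
  then have l_pos: "l n > 0" for n
    by (smt (verit) of_nat_0_le_iff)
  define d where "d = (\<lambda>n. (1 / l n) *\<^sub>R (z n - p))"
  have "d n \<in> sphere 0 1" for n
    using l_pos[of n] by (simp add: d_def l_def)
  then obtain r \<phi> where r: "r \<in> sphere 0 1" "strict_mono \<phi>" "(d \<circ> \<phi>) \<longlonglongrightarrow> r"
    using compact_sphere[of "0::'a" 1] unfolding compact_def by blast
  have "filterlim (\<lambda>n. l (\<phi> n)) at_top sequentially"
  proof (rule filterlim_at_top_mono[OF filterlim_real_sequentially])
    show "\<forall>\<^sub>F n in sequentially. real n \<le> l (\<phi> n)"
    proof (rule always_eventually, rule allI)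
      fix n
      have "real n \<le> real (\<phi> n)"
        using seq_suble[OF r(2), of n] by simp
      then show "real n \<le> l (\<phi> n)"
        using l[of "\<phi> n"] by linarith
    qed
  qed
  then have lim0: "(\<lambda>n. t / l (\<phi> n)) \<longlonglongrightarrow> 0" for t
    by (rule tendsto_divide_0[OF tendsto_const filterlim_at_top_imp_at_infinity])
  have "x + t *\<^sub>R r \<in> X" if x: "x \<in> X" and t: "t \<ge> 0" for x t
  proof (rule Lim_in_closed_set[OF X(1) _ sequentially_bot])
    let ?y = "\<lambda>n. x + (t / l (\<phi> n)) *\<^sub>R (z (\<phi> n) - x)"
    have eq: "?y n = x + t *\<^sub>R (1 / l (\<phi> n)) *\<^sub>R (z (\<phi> n) - p) + (t / l (\<phi> n)) *\<^sub>R (p - x)" for n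
      by (simp add: algebra_simps)
    have "(\<lambda>n. x + t *\<^sub>R (1 / l (\<phi> n)) *\<^sub>R (z (\<phi> n) - p) + (t / l (\<phi> n)) *\<^sub>R (p - x))
        \<longlonglongrightarrow> x + t *\<^sub>R r + 0 *\<^sub>R (p - x)"
      by (intro tendsto_intros lim0 r(3)[unfolded comp_def d_def])
    then show "?y \<longlonglongrightarrow> x + t *\<^sub>R r"
      unfolding eq by simp
    have "\<forall>\<^sub>F n in sequentially. t / l (\<phi> n) < 1"
      using lim0[of t] by (rule order_tendstoD) simp
    then show "\<forall>\<^sub>F n in sequentially. ?y n \<in> X"
    proof (rule eventually_mono)
      fix n assume *: "t / l (\<phi> n) < 1"
      have "?y n = (1 - t / l (\<phi> n)) *\<^sub>R x + (t / l (\<phi> n)) *\<^sub>R z (\<phi> n)"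
        by (simp add: algebra_simps)
      then show "?y n \<in> X"
        using convexD_alt[OF X(2) x z(1)[of "\<phi> n"], of "t / l (\<phi> n)"] * t l_pos[of "\<phi> n"] by simp
    qed
  qed
  moreover have "r \<noteq> 0"
    using r(1) by auto
  ultimately show ?thesis
    using that by blast
qed

subsection \<open>Curves containing a line\<close>

context convex_body
begin

context
  fixes p u :: "real^2"
  assumes u: "u \<noteq> 0" and line: "\<And>t. p + t *\<^sub>R u \<in> C"
begin

text \<open>The target is a limit of points on segments from \<open>x\<close> to ever more distant
  points of the line.\<close>

lemma line_translation: "x \<in> A \<Longrightarrow> x + t *\<^sub>R u \<in> A"
proof (rule Lim_in_closed_set[OF closed _ sequentially_bot])
  assume x: "x \<in> A"
  let ?y = "\<lambda>n. (1 - 1 / (real n + 1)) *\<^sub>R x + (1 / (real n + 1)) *\<^sub>R (p + ((real n + 1) * t) *\<^sub>R u)"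
  have eq: "?y n = x + t *\<^sub>R u + (1 / (real n + 1)) *\<^sub>R (p - x)" for n
  proof -
    have "(1 - e) *\<^sub>R x + e *\<^sub>R (p + s *\<^sub>R u) = x + (e * s) *\<^sub>R u + e *\<^sub>R (p - x)" for e s :: real
      by (simp add: algebra_simps)
    moreover have "(1 / (real n + 1)) * ((real n + 1) * t) = t"
      by (simp add: field_simps)
    ultimately show ?thesis
      by metis
  qed
  have "(\<lambda>n. 1 / (real n + 1)) \<longlonglongrightarrow> 0"
    using LIMSEQ_inverse_real_of_nat by (simp add: inverse_eq_divide add.commute)
  then have "(\<lambda>n. x + t *\<^sub>R u + (1 / (real n + 1)) *\<^sub>R (p - x)) \<longlonglongrightarrow> x + t *\<^sub>R u + 0 *\<^sub>R (p - x)"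
    by (intro tendsto_intros)
  then show "?y \<longlonglongrightarrow> x + t *\<^sub>R u"
    unfolding eq by simp
  have "?y n \<in> A" for n
    by (rule convexD_alt[OF convex x]) (use line C_subset in auto)
  then show "\<forall>\<^sub>F n in sequentially. ?y n \<in> A"
    by simp
qed

lemma line_translation_C:
  assumes "x \<in> C"
  shows "x + t *\<^sub>R u \<in> C"
proof -
  have "(+) ((- t) *\<^sub>R u) ` interior A \<subseteq> interior A"
  proof (rule interior_maximal)
    show "(+) ((- t) *\<^sub>R u) ` interior A \<subseteq> A"
      using line_translation[of _ "- t"] interior_subset[of A] by (force simp: add.commute)
    show "open ((+) ((- t) *\<^sub>R u) ` interior A)"
      by (rule open_translation[OF open_interior])
  qed
  then have "x + t *\<^sub>R u \<in> interior A \<Longrightarrow> x \<in> interior A"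
    by force
  then show ?thesis
    using assms line_translation[of x t] unfolding C_iff by blast
qed

text \<open>Up to scaling, \<open>det2 u\<close> is the height over the line. A boundary point
  \<open>y\<close> of intermediate height would be interior to a triangle with one corner on the
  parallel through \<open>x\<close> and two on the parallel through \<open>z\<close>. So
  \<open>C\<close> consists of at most two parallel lines.\<close>

lemma line_heights_less:
  assumes "x \<in> C" "y \<in> C" "z \<in> C" "det2 u x < det2 u y" "det2 u y < det2 u z"
  shows False
proof -
  define s where "s = (det2 u y - det2 u x) / (det2 u z - det2 u x)"
  have s: "0 < s" "s < 1"
    using assms by (simp_all add: s_def field_simps)
  have "s * (det2 u z - det2 u x) = det2 u y - det2 u x"
    using assms by (simp add: s_def)
  then have "det2 u (y - ((1 - s) *\<^sub>R x + s *\<^sub>R z)) = 0"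
    by (simp add: det2_simps algebra_simps)
  then obtain k where k: "y - ((1 - s) *\<^sub>R x + s *\<^sub>R z) = k *\<^sub>R u"
    using det2_eq_0_imp_parallel u by blast
  have y: "y = (1 - s) *\<^sub>R x + s *\<^sub>R z + k *\<^sub>R u"
    using k by (simp add: algebra_simps)
  have "(1 - s + s / 2 + s / 2) *\<^sub>R y = (1 - s) *\<^sub>R (x + k *\<^sub>R u) + (s / 2) *\<^sub>R (z + (k - 1) *\<^sub>R u)
      + (s / 2) *\<^sub>R (z + (k + 1) *\<^sub>R u)"
    unfolding y by (simp add: vec_eq_iff field_simps)
  then have "orient (x + k *\<^sub>R u) (z + (k - 1) *\<^sub>R u) (z + (k + 1) *\<^sub>R u) = 0"
    by (rule collinear_if_frontier_combination[OF assms(2), rotated -1])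
      (use line_translation s assms(1,3) C_subset in auto)
  moreover have "orient (x + k *\<^sub>R u) (z + (k - 1) *\<^sub>R u) (z + (k + 1) *\<^sub>R u) = 2 * (det2 u x - det2 u z)"
    by (simp add: orient_def det2_def algebra_simps)
  ultimately show False
    using assms by simp
qed

text \<open>Each member of \<open>F\<close> consists of at most two lines parallel to
  \<open>u\<close>, so only heights matter. Two points of \<open>S\<close> at different heights, if
  there are any, fix both lines, and a third test point shows that no other height occurs.\<close>

lemma containment_property_line:
  assumes F: "F \<subseteq> homothets C"
  shows "containment_property P F 3"
  unfolding containment_property_def
proof (intro allI impI)
  fix S
  assume cov: "\<forall>S0. S0 \<subseteq> S \<and> finite S0 \<and> card S0 \<le> 3 \<longrightarrow> (\<exists>T\<in>F. S0 \<subseteq> T)"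
  have heights: "det2 u x = det2 u y \<or> det2 u y = det2 u z \<or> det2 u x = det2 u z"
    if T: "T \<in> F" "{x, y, z} \<subseteq> T" for T x y z
  proof (rule ccontr)
    assume ne: "\<not> ?thesis"
    obtain r v where r: "r > 0" and rv: "T = (\<lambda>x. r *\<^sub>R x + v) ` C"
      using F T(1) unfolding homothets_def by blast
    have "x \<in> T" "y \<in> T" "z \<in> T"
      using T(2) by auto
    then obtain x' y' z' where *: "x = r *\<^sub>R x' + v" "y = r *\<^sub>R y' + v" "z = r *\<^sub>R z' + v"
        "x' \<in> C" "y' \<in> C" "z' \<in> C"
      unfolding rv by (elim imageE) metis
    have "det2 u x' \<noteq> det2 u y'" "det2 u y' \<noteq> det2 u z'" "det2 u x' \<noteq> det2 u z'"
      using ne unfolding * by (auto simp: det2_simps)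
    then consider "det2 u x' < det2 u y'" "det2 u y' < det2 u z'" | "det2 u x' < det2 u z'" "det2 u z' < det2 u y'"
      | "det2 u y' < det2 u x'" "det2 u x' < det2 u z'" | "det2 u y' < det2 u z'" "det2 u z' < det2 u x'"
      | "det2 u z' < det2 u x'" "det2 u x' < det2 u y'" | "det2 u z' < det2 u y'" "det2 u y' < det2 u x'"
      by linarith
    then show False
      using line_heights_less *(4-6) by cases blast+
  qed
  have same_height: "y \<in> T" if T: "T \<in> F" "x \<in> T" "det2 u x = det2 u y" for T x y
  proof -
    obtain r v where r: "r > 0" and rv: "T = (\<lambda>x. r *\<^sub>R x + v) ` C"
      using F T(1) unfolding homothets_def by blast
    then obtain x' where x': "x = r *\<^sub>R x' + v" "x' \<in> C"
      using T(2) by blast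
    have "det2 u (y - x) = 0"
      using T(3) by (simp add: det2_simps)
    then obtain t where "y - x = t *\<^sub>R u"
      using det2_eq_0_imp_parallel u by blast
    then have "y = r *\<^sub>R (x' + (t / r) *\<^sub>R u) + v"
      using r x'(1) by (simp add: algebra_simps)
    then show ?thesis
      using line_translation_C[OF x'(2)] rv by blast
  qed
  show "\<exists>T\<in>F. S \<subseteq> T"
  proof (cases "\<exists>a\<in>S. \<exists>b\<in>S. det2 u a \<noteq> det2 u b")
    case True
    then obtain a b where ab: "a \<in> S" "b \<in> S" "det2 u a \<noteq> det2 u b"
      by blast
    have "{a, b} \<subseteq> S \<and> finite {a, b} \<and> card {a, b} \<le> 3"
      using ab by (simp add: card_insert_if)
    then obtain T where T: "T \<in> F" "{a, b} \<subseteq> T"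
      using cov by blast
    have "s \<in> T" if "s \<in> S" for s
    proof -
      have "{a, b, s} \<subseteq> S \<and> finite {a, b, s} \<and> card {a, b, s} \<le> 3"
        using ab that by (simp add: card_insert_if)
      then obtain T' where "T' \<in> F" "{a, b, s} \<subseteq> T'"
        using cov by blast
      then have "det2 u a = det2 u s \<or> det2 u b = det2 u s"
        using heights[of T' a b s] ab(3) by blast
      then show ?thesis
        using same_height T by blast
    qed
    then show ?thesis
      using T by blast
  next
    case False
    show ?thesis
    proof (cases "S = {}")
      case True
      then show ?thesis
        using cov by auto
    next
      case nonempty: False
      then obtain a where a: "a \<in> S"
        by blast
      then have "{a} \<subseteq> S \<and> finite {a} \<and> card {a} \<le> 3"
        by simp
      then obtain T where T: "T \<in> F" "{a} \<subseteq> T"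
        using cov by blast
      have "s \<in> T" if "s \<in> S" for s
        using same_height[of T a s] T False a that by blast
      then show ?thesis
        using T by blast
    qed
  qed
qed

end

end

subsection \<open>Arbitrary sets and translates\<close>

lemma (in convex_body) curve_family_homothets: "F \<subseteq> homothets C \<Longrightarrow> curve_family F"
proof unfold_locales
  assume F: "F \<subseteq> homothets C"
  show "\<exists>B. convex_body B \<and> T = frontier B" if "T \<in> F" for T
    using homothet_frontier[of T] F that by blast
  show "T = T'" if "T \<in> F" "T' \<in> F" "X \<subseteq> T" "X \<subseteq> T'" "card X = 5" "general_position X" for T T' X
    using homothets_five_points[of T T' X] F that by blast
qed

text \<open>Counterclockwise rotation by a right angle.\<close>

definition perp :: "real^2 \<Rightarrow> real^2" where
  "perp u = vector [- (u$2), u$1]"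

lemma perp_inner: "perp u \<bullet> x = det2 u x"
  by (simp add: perp_def det2_def inner_vec_def sum_2)

lemma perp_eq_0_iff [simp]: "perp u = 0 \<longleftrightarrow> u = 0"
  by (auto simp: perp_def vec_eq_iff forall_2)

text \<open>A supporting functional at the middle point \<open>b - v\<close> is constant on the
  segment. Hence \<open>a - v\<close> lies in one of the two faces of \<open>A\<close> parallel to
  \<open>c - a\<close>, and an unbounded face would contain a half-line.\<close>

lemma (in convex_body) bounded_collinear_positions:
  assumes no_ray: "\<not> (\<exists>p u. u \<noteq> 0 \<and> (\<forall>t\<ge>0. p + t *\<^sub>R u \<in> C))"
    and b: "b \<in> open_segment a c"
  shows "bounded {v. a - v \<in> C \<and> b - v \<in> C \<and> c - v \<in> C}"
proof -
  define face where "face = (\<lambda>u. {x \<in> A. \<forall>y\<in>A. det2 u x \<le> det2 u y})"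
  have bounded_face: "bounded (face u)" if u: "u \<noteq> 0" for u
  proof (rule ccontr)
    have "closed (face u)"
    proof -
      have "face u = A \<inter> (\<Inter>y\<in>A. {x. perp u \<bullet> x \<le> det2 u y})"
        unfolding face_def perp_inner by blast
      then show ?thesis
        using closed by (auto intro!: closed_Int closed_INT closed_halfspace_le)
    qed
    moreover have "convex (face u)"
    proof -
      have "face u = A \<inter> (\<Inter>y\<in>A. {x. perp u \<bullet> x \<le> det2 u y})"
        unfolding face_def perp_inner by blast
      then show ?thesis
        using convex by (auto intro!: convex_Int convex_INT convex_halfspace_le)
    qed
    moreover assume unb: "\<not> bounded (face u)"
    ultimately obtain r where r: "r \<noteq> 0" "\<And>x t. x \<in> face u \<Longrightarrow> t \<ge> 0 \<Longrightarrow> x + t *\<^sub>R r \<in> face u"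
      using closed_convex_unbounded_ray by metis
    moreover obtain x where "x \<in> face u"
      using unb by fastforce
    moreover have "face u \<subseteq> C"
      using frontier_if_minimizes[of "perp u"] u unfolding face_def by (auto simp: perp_inner)
    ultimately show False
      using no_ray by blast
  qed
  define u where "u = c - a"
  have u: "u \<noteq> 0"
    using b by (auto simp: u_def)
  have "{v. a - v \<in> C \<and> b - v \<in> C \<and> c - v \<in> C} \<subseteq> (\<lambda>x. a - x) ` (face u \<union> face (- u))"
  proof
    fix v assume "v \<in> {v. a - v \<in> C \<and> b - v \<in> C \<and> c - v \<in> C}"
    then have v: "a - v \<in> C" "b - v \<in> C" "c - v \<in> C"
      by auto
    obtain n where n: "n \<noteq> 0" "\<And>y. y \<in> A \<Longrightarrow> n \<bullet> (b - v) \<le> n \<bullet> y"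
      using supporting_functional[OF convex closed v(2)] by blast
    obtain s where s: "0 < s" "s < 1" "b = (1 - s) *\<^sub>R a + s *\<^sub>R c"
      using b by (auto simp: in_segment)
    have le: "n \<bullet> b \<le> n \<bullet> a" "n \<bullet> b \<le> n \<bullet> c"
      using n(2)[of "a - v"] n(2)[of "c - v"] v C_subset by (auto simp: inner_diff_right)
    have "(1 - s) * (n \<bullet> a - n \<bullet> b) + s * (n \<bullet> c - n \<bullet> b) = 0"
      unfolding s(3) by (simp add: inner_simps algebra_simps)
    moreover have "(1 - s) * (n \<bullet> a - n \<bullet> b) \<ge> 0" "s * (n \<bullet> c - n \<bullet> b) \<ge> 0"
      using le s by simp_all
    ultimately have "(1 - s) * (n \<bullet> a - n \<bullet> b) = 0" "s * (n \<bullet> c - n \<bullet> b) = 0"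
      by linarith+
    then have eq: "n \<bullet> a = n \<bullet> b" "n \<bullet> u = 0"
      using s by (simp_all add: u_def inner_diff_right)
    have "det2 (perp u) n = 0"
      using eq(2) by (simp add: det2_def perp_def inner_vec_def sum_2 algebra_simps)
    then obtain k where k: "n = k *\<^sub>R perp u"
      using det2_eq_0_imp_parallel u perp_eq_0_iff by metis
    have le': "k * det2 u (a - v) \<le> k * det2 u y" if "y \<in> A" for y
    proof -
      have "n \<bullet> (a - v) \<le> n \<bullet> y"
        using n(2)[OF that] eq(1) by (simp add: inner_diff_right)
      then show ?thesis
        by (simp add: k perp_inner)
    qed
    have "k > 0 \<or> k < 0"
      using n(1) k by auto
    then have "a - v \<in> face u \<union> face (- u)"
      using le' v C_subset unfolding face_def by (auto simp: det2_minus_left)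
    then show "v \<in> (\<lambda>x. a - x) ` (face u \<union> face (- u))"
      by (metis (no_types, lifting) diff_diff_eq2 add_diff_cancel_left' image_eqI)
  qed
  moreover have "bounded ((\<lambda>x. a - x) ` X)" if "bounded X" for X
    using bounded_minus_comp[of "\<lambda>_. a" X "\<lambda>x. x"] that by (simp add: image_constant_conv)
  then have "bounded ((\<lambda>x. a - x) ` (face u \<union> face (- u)))"
    using bounded_face[of u] bounded_face[of "- u"] u by simp
  ultimately show ?thesis
    using bounded_subset by blast
qed

text \<open>If \<open>S\<close> is in general position, five of its points determine the translate.
  Otherwise three collinear points of \<open>S\<close> confine the translation vector to a compact
  set, and the finite intersection property reduces the claim to finite sets, which are
  compact.\<close>

lemma (in convex_body) containment_property_translates_no_ray:
  assumes no_ray: "\<not> (\<exists>p u. u \<noteq> 0 \<and> (\<forall>t\<ge>0. p + t *\<^sub>R u \<in> C))"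
  shows "containment_property P (translates C) 6"
  unfolding containment_property_def
proof (intro allI impI)
  fix S
  assume cov: "\<forall>S0. S0 \<subseteq> S \<and> finite S0 \<and> card S0 \<le> 6 \<longrightarrow> (\<exists>T\<in>translates C. S0 \<subseteq> T)"
  interpret curve_family "translates C"
    by (rule curve_family_homothets[OF translates_subset_homothets])
  show "\<exists>T\<in>translates C. S \<subseteq> T"
  proof (cases "general_position S")
    case gp: True
    show ?thesis
    proof (cases "finite S \<and> card S \<le> 6")
      case True
      then show ?thesis
        using cov by auto
    next
      case False
      then have "infinite S \<or> 5 \<le> card S"
        by linarith
      then obtain X where X: "X \<subseteq> S" "finite X" "card X = 5"
        using infinite_arbitrarily_large[of S 5] obtain_subset_with_card_n[of 5 S] by blast
      then have "general_position X"
        using gp unfolding general_position_def by blast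
      then show ?thesis
        using covered_if_determined[of S 5 "translates C" X] cov X five_points by auto
    qed
  next
    case False
    then obtain x y z where "x \<in> S" "y \<in> S" "z \<in> S" "orient x y z = 0" "x \<noteq> y" "y \<noteq> z" "x \<noteq> z"
      unfolding general_position_def by blast
    then obtain a b c where abc: "a \<in> S" "b \<in> S" "c \<in> S" "b \<in> open_segment a c"
      using collinear_between[of x y z] by blast
    define K where "K = {v. a - v \<in> C \<and> b - v \<in> C \<and> c - v \<in> C}"
    have closed_pos: "closed {v. s - v \<in> C}" for s
      using continuous_closed_vimage[OF frontier_closed, of "\<lambda>v. s - v"] by (simp add: vimage_def)
    have "K = {v. a - v \<in> C} \<inter> {v. b - v \<in> C} \<inter> {v. c - v \<in> C}"
      unfolding K_def by blast
    then have "compact K"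
      using closed_pos bounded_collinear_positions[OF no_ray abc(4)]
      unfolding K_def compact_eq_bounded_closed by auto
    then have "K \<inter> (\<Inter>s\<in>S. {v. s - v \<in> C}) \<noteq> {}"
    proof (rule compact_imp_fip_image)
      fix I assume I: "finite I" "I \<subseteq> S"
      define S' where "S' = I \<union> {a, b, c}"
      have S': "S' \<subseteq> S" "finite S'"
        using I abc by (auto simp: S'_def)
      then have "compact S'" "\<forall>S0. S0 \<subseteq> S' \<and> finite S0 \<and> card S0 \<le> 6 \<longrightarrow> (\<exists>T\<in>translates C. S0 \<subseteq> T)"
        using cov by (auto simp: finite_imp_compact)
      then obtain T where "T \<in> translates C" "S' \<subseteq> T"
        using containment_property_compact unfolding containment_property_def by blast
      then obtain v where "S' \<subseteq> (\<lambda>x. x + v) ` C"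
        unfolding translates_def by blast
      then have "s - v \<in> C" if "s \<in> S'" for s
        using that mem_translate_iff by blast
      then have "v \<in> K \<inter> (\<Inter>s\<in>I. {v. s - v \<in> C})"
        unfolding S'_def K_def by simp
      then show "K \<inter> (\<Inter>s\<in>I. {v. s - v \<in> C}) \<noteq> {}"
        by blast
    qed (rule closed_pos)
    then obtain v where "\<And>s. s \<in> S \<Longrightarrow> s - v \<in> C"
      by blast
    then have "S \<subseteq> (\<lambda>x. x + v) ` C"
      using mem_translate_iff by blast
    then show ?thesis
      unfolding translates_def by blast
  qed
qed

subsection \<open>Strictly convex curves\<close>

locale strict_body = convex_body +
  assumes strict: "\<not> (\<exists>a b. a \<noteq> b \<and> closed_segment a b \<subseteq> frontier A)"
begin

lemma interior_open_segment:
  assumes "p \<in> A" "q \<in> A" "m \<in> open_segment p q"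
  shows "m \<in> interior A"
proof (rule ccontr)
  assume "m \<notin> interior A"
  moreover have "m \<in> A"
    using assms convex convex_contains_open_segment by blast
  ultimately have "m \<in> C"
    by (simp add: C_iff)
  then have "closed_segment p q \<subseteq> C"
    using segment_in_frontier assms by blast
  moreover have "p \<noteq> q"
    using assms(3) by auto
  ultimately show False
    using strict by blast
qed

lemma not_collinear:
  assumes "x \<in> C" "y \<in> C" "z \<in> C" "x \<noteq> y" "y \<noteq> z" "x \<noteq> z"
  shows "orient x y z \<noteq> 0"
  using segment_if_collinear[of x y z] assms strict by metis

lemma homothets_three_points:
  assumes "T \<in> homothets C" "T' \<in> homothets C" "X \<subseteq> T" "X \<subseteq> T'" "card X = 3"
  shows "T = T'"
  using strict_homothets_three_points[OF convex_body_axioms strict] assms by blast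

lemma containment_property_strict:
  assumes "F \<subseteq> homothets C"
  shows "containment_property P F 4"
  using containment_property_if_determined[of 3 F P] homothets_three_points assms
  by (simp add: subset_iff)

text \<open>The direction of the ray points from \<open>x\<close> into the parallelogram. If it is
  parallel to a side, then the end of the side at \<open>x\<close> becomes an inner point of a
  chord; otherwise the opposite vertex \<open>x + u + w\<close> lies inside a triangle whose third
  corner \<open>z\<close> is far out on the ray.\<close>

lemma no_parallelogram_with_ray:
  assumes C: "x \<in> C" "x + u \<in> C" "x + w \<in> C" "x + u + w \<in> C"
    and uw: "det2 u w \<noteq> 0"
    and ray: "\<And>y t. y \<in> A \<Longrightarrow> t \<ge> 0 \<Longrightarrow> y + t *\<^sub>R (a *\<^sub>R u + b *\<^sub>R w) \<in> A"
    and ab: "a \<ge> 0" "b \<ge> 0" "a \<noteq> 0 \<or> b \<noteq> 0"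
  shows False
proof -
  have midpoint_interior: False if "x \<in> C" "x + v \<in> C" "x + 2 *\<^sub>R v \<in> A" "v \<noteq> 0" for v
  proof -
    have "x + v = (1 - 1 / 2) *\<^sub>R x + (1 / 2) *\<^sub>R (x + 2 *\<^sub>R v)"
      by (simp add: vec_eq_iff field_simps)
    then have "x + v \<in> open_segment x (x + 2 *\<^sub>R v)"
      using that(4) unfolding in_segment by (intro conjI exI[of _ "1/2"]) simp_all
    then have "x + v \<in> interior A"
      using interior_open_segment that C_subset by blast
    then show False
      using that(2) C_interior by blast
  qed
  have nz: "u \<noteq> 0" "w \<noteq> 0"
    using uw by auto
  consider "a = 0" "b > 0" | "b = 0" "a > 0" | "a > 0" "b > 0"
    using ab by linarith
  then show False
  proof cases
    case 1
    then show False
      using ray[of x "2 / b"] midpoint_interior[of w] C nz C_subset by auto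
  next
    case 2
    then show False
      using ray[of x "2 / a"] midpoint_interior[of u] C nz C_subset by auto
  next
    case 3
    \<comment> \<open>Far enough that the weights \<open>t * a - 1\<close> and
      \<open>t * b - 1\<close> below are positive.\<close>
    define t where "t = 2 / a + 2 / b"
    have t: "t \<ge> 0" "t * a > 1" "t * b > 1"
      using 3 by (simp_all add: t_def field_simps add_pos_pos)
    define z where "z = x + t *\<^sub>R (a *\<^sub>R u + b *\<^sub>R w)"
    have "z \<in> A"
      using ray[of x t] t C C_subset unfolding z_def by blast
    moreover have "(1 + (t * b - 1) + (t * a - 1)) *\<^sub>R (x + u + w)
        = 1 *\<^sub>R z + (t * b - 1) *\<^sub>R (x + u) + (t * a - 1) *\<^sub>R (x + w)"
      unfolding z_def by (simp add: vec_eq_iff algebra_simps)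
    ultimately have "orient z (x + u) (x + w) = 0"
      using collinear_if_frontier_combination[of "x + u + w" z "x + u" "x + w" 1 "t * b - 1" "t * a - 1"]
        C C_subset t by auto
    moreover have "orient z (x + u) (x + w) = (1 - t * a - t * b) * det2 u w"
      unfolding z_def by (simp add: orient_def det2_def algebra_simps)
    ultimately show False
      using uw t by auto
  qed
qed

text \<open>Two such chords span an inscribed parallelogram, nondegenerate by strict convexity. A
  suitable choice of the base vertex makes both coordinates of the recession direction
  nonnegative.\<close>

lemma unbounded_chord_unique:
  assumes unb: "\<not> bounded A" and C: "x \<in> C" "x + u \<in> C" "y \<in> C" "y + u \<in> C" and u: "u \<noteq> 0"
  shows "x = y"
proof (rule ccontr)
  assume "x \<noteq> y"
  define w where "w = y - x"
  have w: "w \<noteq> 0" "y = x + w"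
    using \<open>x \<noteq> y\<close> by (simp_all add: w_def)
  have uw: "det2 u w \<noteq> 0"
  proof (cases "w = u")
    \<comment> \<open>Then \<open>x\<close>, \<open>x + u\<close>, \<open>x + 2 u\<close> are three
      collinear points of \<open>C\<close>, so this case is contradictory.\<close>
    case True
    then have "y + u = x + 2 *\<^sub>R u"
      using w by (simp add: vec_eq_iff)
    then have "x + 2 *\<^sub>R u \<in> C"
      using C by simp
    moreover have "x + 2 *\<^sub>R u - (x + u) = u"
      by (simp add: vec_eq_iff)
    then have "x + u \<noteq> x + 2 *\<^sub>R u"
      using u by auto
    ultimately have "orient x (x + u) (x + 2 *\<^sub>R u) \<noteq> 0"
      using C u by (intro not_collinear) simp_all
    then show ?thesis
      by (simp add: orient_def det2_simps)
  next
    case False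
    then have "orient x (x + u) y \<noteq> 0"
      using not_collinear[of x "x + u" y] C u w by auto
    then show ?thesis
      using w by (simp add: orient_def)
  qed
  obtain r where r: "r \<noteq> 0" "\<And>y t. y \<in> A \<Longrightarrow> t \<ge> 0 \<Longrightarrow> y + t *\<^sub>R r \<in> A"
    using closed_convex_unbounded_ray[OF closed convex unb] by metis
  obtain a b where ab: "r = a *\<^sub>R u + b *\<^sub>R w"
    using det2_basis[OF uw] by blast
  have nz: "a \<noteq> 0 \<or> b \<noteq> 0"
    using r(1) ab by auto
  have para: False if "z \<in> C" "z + u' \<in> C" "z + w' \<in> C" "z + u' + w' \<in> C" "det2 u' w' \<noteq> 0"
      "r = a' *\<^sub>R u' + b' *\<^sub>R w'" "a' \<ge> 0" "b' \<ge> 0" "a' \<noteq> 0 \<or> b' \<noteq> 0" for z u' w' a' b'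
    using no_parallelogram_with_ray[of z u' w' a' b'] that r(2) by blast
  have C': "x \<in> C" "x + u \<in> C" "x + w \<in> C" "x + u + w \<in> C"
    using C w(2) by (simp_all add: algebra_simps)
  consider "a \<ge> 0" "b \<ge> 0" | "a \<ge> 0" "b \<le> 0" | "a \<le> 0" "b \<ge> 0" | "a \<le> 0" "b \<le> 0"
    by linarith
  then show False
  proof cases
    case 1
    then show False
      using para[of x u w a b] C' uw ab nz by blast
  next
    case 2
    then show False
      using para[of "x + w" u "- w" a "- b"] C' uw ab nz by (simp add: det2_minus_right algebra_simps)
  next
    case 3
    then show False
      using para[of "x + u" "- u" w "- a" b] C' uw ab nz by (simp add: det2_minus_left algebra_simps)
  next
    case 4
    then show False
      using para[of "x + u + w" "- u" "- w" "- a" "- b"] C' uw ab nz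
      by (simp add: det2_minus_left det2_minus_right algebra_simps)
  qed
qed

lemma containment_property_unbounded:
  assumes unb: "\<not> bounded A"
  shows "containment_property P (translates C) 3"
proof -
  have "T = T'" if X: "card X = 2" "T \<in> translates C" "T' \<in> translates C" "X \<subseteq> T" "X \<subseteq> T'" for X T T'
  proof -
    obtain p q where pq: "X = {p, q}" "p \<noteq> q"
      using X(1) by (meson card_2_iff)
    obtain v v' where v: "T = (\<lambda>x. x + v) ` C" "T' = (\<lambda>x. x + v') ` C"
      using X(2,3) unfolding translates_def by blast
    have "p - v \<in> C" "q - v \<in> C" "p - v' \<in> C" "q - v' \<in> C"
      using X(4,5) pq v by (auto simp: mem_translate_iff[symmetric])
    then have "p - v = p - v'"
      using unbounded_chord_unique[OF unb, of "p - v" "q - p" "p - v'"] pq(2) by simp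
    then show ?thesis
      using v by simp
  qed
  then show ?thesis
    using containment_property_if_determined[of 2 "translates C" P] by simp
qed

text \<open>The pair \<open>- x\<close>, \<open>- y\<close> is the pair \<open>y\<close>,
  \<open>x\<close> shifted by \<open>- x - y\<close>, so all pairs of the reflected triangle are
  covered. If one translate contained all three points, uniqueness of the chords along
  \<open>q - p\<close> and \<open>q - r\<close> would place \<open>- q - v\<close> at both
  \<open>p\<close> and \<open>r\<close>.\<close>

lemma not_containment_property_unbounded:
  assumes unb: "\<not> bounded C"
  shows "\<not> containment_property (\<lambda>S. True) (translates C) 2"
proof
  assume small: "containment_property (\<lambda>S. True) (translates C) 2"
  have unbA: "\<not> bounded A"
    using unb C_subset bounded_subset by blast
  have "infinite C"
    using unb finite_imp_bounded by blast
  then obtain X where "X \<subseteq> C" "card X = 3"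
    using infinite_arbitrarily_large by blast
  then obtain p q r where pqr: "p \<in> C" "q \<in> C" "r \<in> C" "p \<noteq> q" "q \<noteq> r" "p \<noteq> r"
    using card_3_iff[of X] by auto
  have pair: "\<exists>T\<in>translates C. {- x, - y} \<subseteq> T" if "x \<in> C" "y \<in> C" for x y
  proof -
    have "{- x, - y} \<subseteq> (\<lambda>z. z + (- x - y)) ` C"
      using that by (simp add: mem_translate_iff)
    then show ?thesis
      unfolding translates_def by blast
  qed
  have "\<exists>T\<in>translates C. S0 \<subseteq> T" if S0: "S0 \<subseteq> {- p, - q, - r}" "finite S0" "card S0 \<le> 2" for S0
  proof -
    have "card {- p, - q, - r} = 3"
      using pqr by simp
    then have "S0 \<noteq> {- p, - q, - r}"
      using S0(3) by auto
    then have "S0 \<subseteq> {- p, - q} \<or> S0 \<subseteq> {- q, - r} \<or> S0 \<subseteq> {- p, - r}"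
      using S0(1) by blast
    then show ?thesis
      using pair[of p q] pair[of q r] pair[of p r] pqr by (meson order_trans)
  qed
  then obtain T where "T \<in> translates C" "{- p, - q, - r} \<subseteq> T"
    using small unfolding containment_property_def by blast
  then obtain v where "{- p, - q, - r} \<subseteq> (\<lambda>x. x + v) ` C"
    unfolding translates_def by blast
  then have v: "- p - v \<in> C" "- q - v \<in> C" "- r - v \<in> C"
    by (simp_all only: mem_translate_iff[symmetric] insert_subset)
  have "- q - v = p"
    using unbounded_chord_unique[OF unbA, of "- q - v" "q - p" p] v pqr by (simp add: algebra_simps)
  moreover have "- q - v = r"
    using unbounded_chord_unique[OF unbA, of "- q - v" "q - r" r] v pqr by (simp add: algebra_simps)
  ultimately show False
    using pqr by simp
qed

end

section \<open>Symmetric hexagons inscribed in bounded strictly convex curves\<close>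

lemma det2_perp: "det2 u (perp u) = (norm u)\<^sup>2"
  by (simp add: det2_def perp_def power2_norm_eq_inner inner_vec_def sum_2)

lemma norm_perp [simp]: "norm (perp u) = norm u"
  by (simp add: perp_def norm_eq_sqrt_inner inner_vec_def sum_2 add.commute)

context strict_body
begin

text \<open>The outside of a large ball is connected and misses \<open>C\<close>, so it lies outside
  or inside \<open>A\<close>. In the latter case convexity gives the whole plane, which has no
  boundary.\<close>

lemma bounded_if_bounded_frontier:
  assumes "bounded C" "C \<noteq> {}"
  shows "bounded A"
proof -
  obtain M where M: "\<And>x. x \<in> C \<Longrightarrow> norm x \<le> M"
    using assms(1) bounded_iff by blast
  let ?K = "- cball (0 :: real^2) M"
  have "connected ?K"
    by (rule connected_complement_bounded_convex) auto
  moreover have "?K \<inter> C = {}"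
    using M by force
  ultimately consider "?K \<inter> A = {}" | "?K \<subseteq> A"
    using connected_Int_frontier[of ?K A] by blast
  then show ?thesis
  proof cases
    case 1
    then have "A \<subseteq> cball 0 M"
      by blast
    then show ?thesis
      using bounded_cball bounded_subset by blast
  next
    case 2
    have "x \<in> A" for x
    proof -
      obtain d :: "real^2" where d: "norm d = norm x + \<bar>M\<bar> + 1"
        by (rule vector_choose_size[of "norm x + \<bar>M\<bar> + 1"]) auto
      have "norm (x + d) > M" "norm (x - d) > M"
        using d norm_diff_ineq[of d x] norm_triangle_ineq2[of d x]
        by (simp_all add: add.commute norm_minus_commute)
      then have "x + d \<in> A" "x - d \<in> A"
        using 2 by auto
      then have "closed_segment (x + d) (x - d) \<subseteq> A"
        by (intro closed_segment_subset convex)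
      then have "midpoint (x + d) (x - d) \<in> A"
        using midpoint_in_closed_segment by blast
      moreover have "midpoint (x + d) (x - d) = x"
        by (simp add: midpoint_def vec_eq_iff)
      ultimately show ?thesis
        by simp
    qed
    then have "A = UNIV"
      by blast
    then show ?thesis
      using assms(2) by simp
  qed
qed

lemma interior_before:
  assumes "m \<in> interior A" "m + f *\<^sub>R v \<in> A" "0 \<le> e" "e < f"
  shows "m + e *\<^sub>R v \<in> interior A"
proof (cases "e = 0 \<or> v = 0")
  case True
  then show ?thesis
    using assms(1) by auto
next
  case False
  define k where "k = e / f"
  have k: "0 < k" "k < 1" "e = k * f"
    using False assms(3,4) by (simp_all add: k_def)
  have "m + e *\<^sub>R v = (1 - k) *\<^sub>R m + k *\<^sub>R (m + f *\<^sub>R v)"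
    unfolding k(3) by (simp add: algebra_simps)
  moreover have "m \<noteq> m + f *\<^sub>R v"
    using False assms(3,4) by auto
  ultimately have "m + e *\<^sub>R v \<in> open_segment m (m + f *\<^sub>R v)"
    using k(1,2) unfolding in_segment by blast
  then show ?thesis
    using interior_open_segment assms(1,2) interior_subset by blast
qed

lemma translate_eq_self:
  assumes "(\<lambda>x. x + v) ` C = C" "C \<noteq> {}"
  shows "v = 0"
proof (rule ccontr)
  assume v: "v \<noteq> 0"
  obtain x where x: "x \<in> C"
    using assms(2) by blast
  have step: "y + v \<in> C" if "y \<in> C" for y
    using that assms(1) by blast
  have ne: "a \<noteq> a + v" for a
    using v by simp
  have "orient x (x + v) (x + v + v) \<noteq> 0"
  proof (rule not_collinear[OF x step[OF x] step[OF step[OF x]] ne ne])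
    have "x + v + v - x = 2 *\<^sub>R v"
      by (simp add: vec_eq_iff)
    then show "x \<noteq> x + v + v"
      using v by (metis diff_self scaleR_eq_0_iff zero_neq_numeral)
  qed
  then show False
    by (simp add: orient_def det2_def algebra_simps)
qed

text \<open>The starting points of chords with vector \<open>u\<close> are common to
  \<open>C\<close> and its translate by \<open>- u\<close>, and three of them would make the two
  equal.\<close>

lemma three_chords:
  assumes u: "u \<noteq> 0" and C: "x \<in> C" "x + u \<in> C" "y \<in> C" "y + u \<in> C" "z \<in> C" "z + u \<in> C"
  shows "x = y \<or> y = z \<or> x = z"
proof (rule ccontr)
  assume ne: "\<not> ?thesis"
  let ?T = "(\<lambda>x. x + (- u)) ` C"
  have self: "C = (\<lambda>x. x + 0) ` C"
    by simp
  have "C \<in> translates C" "?T \<in> translates C"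
    unfolding translates_def using self by blast+
  moreover have "{x, y, z} \<subseteq> ?T"
    using C by (simp only: mem_translate_iff insert_subset) simp
  moreover have "card {x, y, z} = 3"
    using ne by simp
  ultimately have "C = ?T"
    using homothets_three_points[of C ?T "{x, y, z}"] C translates_subset_homothets[of C] by blast
  then show False
    using translate_eq_self[of "- u"] u C by auto
qed

end

text \<open>The number \<open>\<delta>\<close> is the length of the chords considered. The doubled
  radius makes room for such a chord at distance \<open>\<delta>\<close> from the centre
  \<open>o'\<close>, whatever its direction.\<close>

locale compact_strict_body = strict_body +
  fixes o' :: "real^2" and \<delta> :: real
  assumes bounded: "bounded A" and \<delta>: "\<delta> > 0" and ball: "cball o' (2 * \<delta>) \<subseteq> A"
begin

text \<open>Among all segments with vector \<open>u\<close> in \<open>A\<close> take a highest one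
  with respect to \<open>det2 u\<close>; comparing it with the one starting at
  \<open>o' + perp u\<close> gives the bound. Its inner points are interior to \<open>A\<close>. If
  an end were interior too, sliding the segment a little along itself would make both ends interior,
  and it could be raised.\<close>

lemma chord_exists:
  assumes u: "norm u = \<delta>"
  obtains x where "x \<in> C" "x + u \<in> C" "\<delta>\<^sup>2 \<le> det2 u (x - o')"
proof -
  have u0: "u \<noteq> 0"
    using u \<delta> by auto
  define Q where "Q = A \<inter> (\<lambda>x. x + u) -` A"
  have "compact Q"
    unfolding Q_def using bounded closed
    by (auto simp: compact_eq_bounded_closed intro!: closed_Int closed_vimage continuous_intros
        intro: bounded_subset)
  moreover have ob: "o' + perp u \<in> Q"
  proof -
    have "norm (perp u + u) \<le> 2 * \<delta>"
      using norm_triangle_ineq[of "perp u" u] u by simp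
    then show ?thesis
      unfolding Q_def using ball u \<delta> by (auto simp: dist_norm norm_minus_commute add.assoc subset_iff)
  qed
  moreover have "continuous_on Q (det2 u)"
    by (intro continuous_intros)
  ultimately obtain x where x: "x \<in> Q" "\<And>y. y \<in> Q \<Longrightarrow> det2 u y \<le> det2 u x"
    using continuous_attains_sup[of Q "det2 u"] by blast
  have not_int: False if y: "y \<in> interior A" "y + u \<in> interior A" "det2 u y = det2 u x" for y
  proof -
    obtain e1 where e1: "e1 > 0" "cball y e1 \<subseteq> A"
      using y(1) by (meson mem_interior_cball)
    obtain e2 where e2: "e2 > 0" "cball (y + u) e2 \<subseteq> A"
      using y(2) by (meson mem_interior_cball)
    define s where "s = min e1 e2 / \<delta>"
    have s: "s > 0" "s * \<delta> \<le> e1" "s * \<delta> \<le> e2"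
      using e1 e2 \<delta> by (auto simp: s_def field_simps)
    have "y + s *\<^sub>R perp u \<in> cball y e1" "y + u + s *\<^sub>R perp u \<in> cball (y + u) e2"
      using s u by (simp_all add: dist_norm)
    then have "y + s *\<^sub>R perp u \<in> Q"
      unfolding Q_def using e1 e2 by (auto simp: algebra_simps)
    then have "det2 u (y + s *\<^sub>R perp u) \<le> det2 u x"
      by (rule x(2))
    then show False
      using s u \<delta> y(3) by (simp add: det2_simps det2_perp mult_le_0_iff)
  qed
  have xA: "x \<in> A" "x + u \<in> A"
    using x(1) by (auto simp: Q_def)
  have move: "\<exists>k. 0 < k \<and> k < 1 \<and> p + k *\<^sub>R q \<in> interior A" if p: "p \<in> interior A" for p q
  proof -
    have "((\<lambda>k. p + k *\<^sub>R q) \<longlongrightarrow> p + 0 *\<^sub>R q) (at_right (0::real))"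
      by (intro tendsto_intros)
    then have "\<forall>\<^sub>F k in at_right (0::real). p + k *\<^sub>R q \<in> interior A"
      using topological_tendstoD[OF _ open_interior] p by simp
    moreover have "\<forall>\<^sub>F k in at_right (0::real). k \<in> {0<..<1}"
      by (rule eventually_at_right_real) simp
    ultimately have "\<forall>\<^sub>F k in at_right (0::real). 0 < k \<and> k < 1 \<and> p + k *\<^sub>R q \<in> interior A"
      by eventually_elim auto
    then show ?thesis
      using eventually_happens'[OF trivial_limit_at_right_real] by blast
  qed
  have on_chord: "x + k *\<^sub>R u \<in> interior A" if "0 < k" "k < 1" for k
  proof (rule interior_open_segment[OF xA])
    have "x + k *\<^sub>R u = (1 - k) *\<^sub>R x + k *\<^sub>R (x + u)"
      by (simp add: algebra_simps)
    then show "x + k *\<^sub>R u \<in> open_segment x (x + u)"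
      using that u0 unfolding in_segment by auto
  qed
  have "x \<notin> interior A"
  proof
    assume "x \<in> interior A"
    then obtain k where k: "0 < k" "k < 1" "x + k *\<^sub>R (- u) \<in> interior A"
      using move by blast
    have eq: "x + k *\<^sub>R (- u) + u = x + (1 - k) *\<^sub>R u"
      by (simp add: algebra_simps)
    have "x + k *\<^sub>R (- u) + u \<in> interior A"
      unfolding eq by (rule on_chord) (use k in auto)
    from not_int[OF k(3) this] show False
      by (simp add: det2_simps)
  qed
  moreover have "x + u \<notin> interior A"
  proof
    assume "x + u \<in> interior A"
    then obtain k where k: "0 < k" "k < 1" "x + u + k *\<^sub>R u \<in> interior A"
      using move by blast
    have eq: "x + u + k *\<^sub>R u = x + k *\<^sub>R u + u"
      by (simp add: algebra_simps)
    from not_int[OF on_chord[OF k(1,2)] k(3)[unfolded eq]] show False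
      by (simp add: det2_simps)
  qed
  moreover have "\<delta>\<^sup>2 \<le> det2 u (x - o')"
    using x(2)[OF ob] u by (simp add: det2_simps det2_perp)
  ultimately show ?thesis
    using that xA by (simp add: C_iff)
qed

text \<open>Applying existence to \<open>- u\<close> gives a chord parallel to \<open>u\<close> on
  the other side of \<open>o'\<close>, and there are at most two such chords altogether.\<close>

lemma chord_unique:
  assumes u: "norm u = \<delta>"
    and x: "x \<in> C" "x + u \<in> C" "\<delta>\<^sup>2 \<le> det2 u (x - o')"
    and x': "x' \<in> C" "x' + u \<in> C" "\<delta>\<^sup>2 \<le> det2 u (x' - o')"
  shows "x = x'"
proof -
  obtain y where y: "y \<in> C" "y + - u \<in> C" "\<delta>\<^sup>2 \<le> det2 (- u) (y - o')"
    using chord_exists[of "- u"] u by (metis norm_minus_cancel)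
  have "det2 u (y - u - o') < 0"
    using y(3) \<delta> by (simp add: det2_simps) (smt (verit) zero_less_power)
  moreover have "det2 u (x - o') > 0" "det2 u (x' - o') > 0"
    using x(3) x'(3) \<delta> zero_less_power[OF \<delta>, of 2] by linarith+
  ultimately have "x \<noteq> y - u" "x' \<noteq> y - u"
    by auto
  moreover have "u \<noteq> 0"
    using u \<delta> by auto
  ultimately show ?thesis
    using three_chords[of u x x' "y - u"] x x' y by simp
qed

text \<open>The parallelogram \<open>x\<close>, \<open>x + u\<close>, \<open>y\<close>, \<open>y - u\<close> is inscribed in \<open>C\<close>; the point \<open>c\<close> lies on
  its midline beyond the side \<open>x\<close>, \<open>x + u\<close>, at most as far from the centre as the curve
  is on the opposite side.\<close>
definition config :: "real^2 \<Rightarrow> real^2 \<Rightarrow> real^2 \<Rightarrow> real^2 \<Rightarrow> bool" where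
  "config u x y c \<longleftrightarrow> x \<in> C \<and> x + u \<in> C \<and> \<delta>\<^sup>2 \<le> det2 u (x - o') \<and>
     y \<in> C \<and> y - u \<in> C \<and> \<delta>\<^sup>2 \<le> - det2 u (y - o') \<and> c \<in> C \<and> x + y - c \<in> A \<and>
     det2 (x - y + u) (2 *\<^sub>R c - (x + y)) = 0 \<and> 0 \<le> (2 *\<^sub>R c - (x + y)) \<bullet> (x - y + u)"

lemma config_geometry:
  assumes "config u x y c"
  shows "det2 u (x - y + u) > 0" "(1 / 2) *\<^sub>R (x + y) \<in> interior A"
proof -
  have "det2 u (x - y) \<ge> 2 * \<delta>\<^sup>2"
    using assms unfolding config_def by (simp add: det2_simps)
  then have pos: "det2 u (x - y) > 0"
    using zero_less_power[OF \<delta>, of 2] by linarith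
  then show "det2 u (x - y + u) > 0"
    by (simp add: det2_simps)
  have "x \<noteq> y"
    using pos by auto
  then have "(1 / 2) *\<^sub>R (x + y) \<in> open_segment x y"
    unfolding in_segment by (intro conjI exI[of _ "1 / 2"]) (auto simp: algebra_simps)
  then show "(1 / 2) *\<^sub>R (x + y) \<in> interior A"
    using interior_open_segment assms C_subset unfolding config_def by blast
qed

text \<open>From the centre \<open>m\<close> of the parallelogram the midline meets \<open>C\<close>
  in both directions \<open>w\<close> and \<open>- w\<close>. The nearer intersection serves as
  \<open>c\<close>; if it lies in direction \<open>- w\<close>, the two sides exchange roles and
  \<open>u\<close> changes sign.\<close>

lemma config_exists:
  assumes u: "norm u = \<delta>"
  shows "(\<exists>x y c. config u x y c) \<or> (\<exists>x y c. config (- u) x y c)"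
proof -
  obtain x where x: "x \<in> C" "x + u \<in> C" "\<delta>\<^sup>2 \<le> det2 u (x - o')"
    using chord_exists[OF u] by blast
  obtain y where y: "y \<in> C" "y + - u \<in> C" "\<delta>\<^sup>2 \<le> det2 (- u) (y - o')"
    using chord_exists[of "- u"] u by (metis norm_minus_cancel)
  define m where "m = (1 / 2) *\<^sub>R (x + y)"
  define w where "w = x - y + u"
  have "det2 u (x - y) \<ge> 2 * \<delta>\<^sup>2"
    using x(3) y(3) by (simp add: det2_simps)
  then have pos: "det2 u (x - y) > 0"
    using zero_less_power[OF \<delta>, of 2] by linarith
  then have w: "w \<noteq> 0"
    by (auto simp: w_def det2_simps dest: arg_cong[of _ _ "det2 u"])
  have "x \<noteq> y"
    using pos by auto
  then have "m \<in> open_segment x y"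
    unfolding in_segment m_def by (intro conjI exI[of _ "1 / 2"]) (auto simp: algebra_simps)
  then have m: "m \<in> interior A"
    using interior_open_segment x y C_subset by blast
  obtain d where d: "d > 0" "m + d *\<^sub>R w \<in> C"
    using ray_to_frontier[OF bounded m w] by blast
  obtain d' where d': "d' > 0" "m + d' *\<^sub>R (- w) \<in> C"
    using ray_to_frontier[OF bounded m, of "- w"] w by auto
  have inside: "m + e *\<^sub>R v \<in> A" if "m + f *\<^sub>R v \<in> C" "0 \<le> e" "e \<le> f" "f > 0" for e f v
  proof -
    have "m + e *\<^sub>R v = (1 - e / f) *\<^sub>R m + (e / f) *\<^sub>R (m + f *\<^sub>R v)"
      using that by (simp add: algebra_simps)
    then show ?thesis
      using convexD_alt[OF convex, of m "m + f *\<^sub>R v" "e / f"] that m interior_subset C_subset by auto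
  qed
  have xy: "x + y = 2 *\<^sub>R m"
    by (simp add: m_def)
  show ?thesis
  proof (cases "d \<le> d'")
    case True
    have "x + y - (m + d *\<^sub>R w) = m + d *\<^sub>R (- w)" "2 *\<^sub>R (m + d *\<^sub>R w) - (x + y) = (2 * d) *\<^sub>R w"
      unfolding xy by (simp_all add: vec_eq_iff)
    then have "config u x y (m + d *\<^sub>R w)"
      using inside[OF d'(2), of d] d d' True x y
      unfolding config_def by (simp add: w_def[symmetric] det2_simps)
    then show ?thesis
      by blast
  next
    case False
    have "y + x - (m + d' *\<^sub>R (- w)) = m + d' *\<^sub>R w" "2 *\<^sub>R (m + d' *\<^sub>R (- w)) - (y + x) = (2 * d') *\<^sub>R (- w)"
      unfolding add.commute[of y x] xy by (simp_all add: vec_eq_iff)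
    moreover have "y - x + - u = - w"
      by (simp add: w_def)
    ultimately have "config (- u) y x (m + d' *\<^sub>R (- w))"
      using inside[OF d(2), of d'] d d' False x y
      unfolding config_def by (simp add: det2_simps)
    then show ?thesis
      by blast
  qed
qed

text \<open>All conditions in \<open>config\<close> are closed, so this set is the projection of a
  compact set of quadruples.\<close>

lemma closed_config: "closed {u. norm u = \<delta> \<and> (\<exists>x y c. config u x y c)}"
proof -
  define W where "W = (sphere 0 \<delta> \<times> C \<times> C \<times> C) \<inter>
    {(u, x, y, c). x + u \<in> C \<and> \<delta>\<^sup>2 \<le> det2 u (x - o') \<and>
     y - u \<in> C \<and> \<delta>\<^sup>2 \<le> - det2 u (y - o') \<and> x + y - c \<in> A \<and>
     det2 (x - y + u) (2 *\<^sub>R c - (x + y)) = 0 \<and> 0 \<le> (2 *\<^sub>R c - (x + y)) \<bullet> (x - y + u)}"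
  have "compact C"
    using bounded C_subset bounded_subset by (auto simp: compact_eq_bounded_closed)
  then have comp: "compact (sphere (0::real^2) \<delta> \<times> C \<times> C \<times> C)"
    by (intro compact_Times compact_sphere)
  have closed_mem: "closed {w. f w \<in> K}" if "closed K" "continuous_on UNIV f"
    for K :: "(real^2) set" and f :: "(real^2) \<times> (real^2) \<times> (real^2) \<times> (real^2) \<Rightarrow> real^2"
    using closed_vimage[OF that] by (simp add: vimage_def)
  have "closed {(u, x, y, c). x + u \<in> C \<and> \<delta>\<^sup>2 \<le> det2 u (x - o') \<and>
     y - u \<in> C \<and> \<delta>\<^sup>2 \<le> - det2 u (y - o') \<and> x + y - c \<in> A \<and>
     det2 (x - y + u) (2 *\<^sub>R c - (x + y)) = 0 \<and> 0 \<le> (2 *\<^sub>R c - (x + y)) \<bullet> (x - y + u)}"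
    unfolding case_prod_unfold
    by (intro closed_Collect_conj closed_mem closed_Collect_le closed_Collect_eq frontier_closed closed
        continuous_intros)
  then have "compact W"
    unfolding W_def using comp by (rule compact_Int_closed[rotated])
  then have "compact (fst ` W)"
    by (intro compact_continuous_image continuous_intros)
  moreover have W: "W = {(u, x, y, c). norm u = \<delta> \<and> config u x y c}"
    unfolding W_def config_def by auto
  have "fst ` W = {u. \<exists>x y c. (u, x, y, c) \<in> W}"
    by force
  then have "fst ` W = {u. norm u = \<delta> \<and> (\<exists>x y c. config u x y c)}"
    unfolding W by simp
  ultimately show ?thesis
    using compact_imp_closed by metis
qed

text \<open>Rotating \<open>u\<close> into \<open>- u\<close> exchanges the two sides of the parallelogram, so by
  connectedness of the circle the midline chord is bisected by the centre for some \<open>u\<close>.\<close>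
lemma inscribed_symmetric_hexagon:
  obtains u x y c where "norm u = \<delta>" "config u x y c" "x + y - c \<in> C"
proof -
  define U where "U = {u. norm u = \<delta> \<and> (\<exists>x y c. config u x y c)}"
  have clU: "closed U" "closed (uminus ` U)"
    using closed_config closed_negations unfolding U_def by auto
  have cover: "sphere 0 \<delta> \<subseteq> U \<union> uminus ` U"
  proof
    fix u :: "real^2" assume "u \<in> sphere 0 \<delta>"
    then have "norm u = \<delta>" by simp
    then have "u \<in> U \<or> - u \<in> U"
      using config_exists[of u] unfolding U_def by simp
    then show "u \<in> U \<union> uminus ` U"
      by (metis UnCI add.inverse_inverse imageI)
  qed
  have U_sub: "U \<subseteq> sphere 0 \<delta>" "uminus ` U \<subseteq> sphere 0 \<delta>"
    unfolding U_def by auto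
  have "sphere (0::real^2) \<delta> \<noteq> {}"
    using \<delta> by (simp add: sphere_eq_empty)
  then have ne: "U \<noteq> {}" "uminus ` U \<noteq> {}"
    using cover by auto
  have conn: "connected (sphere (0::real^2) \<delta>)"
    by (rule connected_sphere) simp
  have "U \<inter> uminus ` U \<noteq> {}"
  proof
    assume "U \<inter> uminus ` U = {}"
    then have "U \<inter> sphere 0 \<delta> = {} \<or> uminus ` U \<inter> sphere 0 \<delta> = {}"
      using connected_closedD[OF conn _ cover clU] by simp
    then show False
      using ne U_sub by blast
  qed
  then obtain u where "u \<in> U" "- u \<in> U"
    by auto
  then have u: "norm u = \<delta>" "\<exists>x y c. config u x y c" "\<exists>x y c. config (- u) x y c"
    unfolding U_def by blast+
  \<comment> \<open>The second configuration is named with the sides exchanged, since uniqueness of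
    the chords will identify both parallelograms.\<close>
  then obtain x y c x' y' c' where conf: "config u x y c" "config (- u) y' x' c'"
    by blast
  have "x' = x"
    using chord_unique[OF u(1), of x' x] conf unfolding config_def by (simp add: det2_minus_left)
  moreover have "y' = y"
    using chord_unique[of "- u" y' y] u(1) conf unfolding config_def by (simp add: det2_minus_left)
  ultimately have conf': "config (- u) y x c'"
    using conf(2) by simp
  define m where "m = (1 / 2) *\<^sub>R (x + y)"
  define w where "w = x - y + u"
  have xy: "x + y = 2 *\<^sub>R m"
    by (simp add: m_def)
  have m: "m \<in> interior A" and w: "w \<noteq> 0"
    using config_geometry[OF conf(1)] unfolding m_def w_def by auto
  have param: "\<exists>s\<ge>0. c = m + s *\<^sub>R v" if v: "v \<noteq> 0" "det2 v (2 *\<^sub>R c - 2 *\<^sub>R m) = 0" "0 \<le> (2 *\<^sub>R c - 2 *\<^sub>R m) \<bullet> v" for v c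
  proof -
    obtain s where s: "2 *\<^sub>R c - 2 *\<^sub>R m = s *\<^sub>R v"
      using v(1,2) det2_eq_0_imp_parallel by blast
    have "0 \<le> s * (v \<bullet> v)" "v \<bullet> v > 0"
      using v(1,3) unfolding s by simp_all
    then have "s \<ge> 0"
      using mult_neg_pos[of s "v \<bullet> v"] by linarith
    moreover have "c = m + (s / 2) *\<^sub>R v"
    proof -
      have "c = m + (1 / 2) *\<^sub>R (2 *\<^sub>R c - 2 *\<^sub>R m)"
        by (simp add: vec_eq_iff field_simps)
      then show ?thesis
        unfolding s by simp
    qed
    ultimately show ?thesis
      by (intro exI[of _ "s / 2"]) simp
  qed
  obtain s where s: "s \<ge> 0" "c = m + s *\<^sub>R w"
    using param[OF w, of c] conf(1) unfolding config_def w_def xy by blast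
  have "y + x = 2 *\<^sub>R m" "y - x + - u = - w"
    using xy by (simp_all add: w_def add.commute)
  then obtain s' where s': "s' \<ge> 0" "c' = m + s' *\<^sub>R (- w)"
    using param[of "- w" c'] conf' w unfolding config_def by (metis neg_equal_0_iff_equal)
  have beyond: False if "m + e *\<^sub>R v \<in> C" "m + f *\<^sub>R v \<in> A" "0 \<le> e" "e < f" for e f v
    using interior_before[OF m that(2-4)] that(1) C_interior by blast
  have "x + y - c = m + s *\<^sub>R (- w)" "y + x - c' = m + s' *\<^sub>R w"
    unfolding add.commute[of y x] xy s(2) s'(2) by (simp_all add: vec_eq_iff)
  then have opp: "m + s *\<^sub>R w \<in> C" "m + s *\<^sub>R (- w) \<in> A" "m + s' *\<^sub>R (- w) \<in> C" "m + s' *\<^sub>R w \<in> A"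
    using conf(1) conf' s s' unfolding config_def by simp_all
  \<comment> \<open>On each side the curve point is followed on the same ray by no further point of
    \<open>A\<close>, while the reflection of the opposite curve point is still in
    \<open>A\<close>.\<close>
  have "\<not> s < s'" "\<not> s' < s"
    using beyond[OF opp(1,4) s(1)] beyond[OF opp(3,2) s'(1)] by blast+
  then have "s = s'"
    by simp
  then have "x + y - c \<in> C"
    using opp(3) \<open>x + y - c = m + s *\<^sub>R (- w)\<close> by simp
  then show ?thesis
    using that u(1) conf(1) by blast
qed

text \<open>With \<open>w = x - y + u\<close>, any three of the points \<open>x\<close>, \<open>x + u\<close>, \<open>c\<close>, \<open>c + w\<close> lie in a
  translate of \<open>C\<close>, by one of the vectors \<open>0\<close>, \<open>w\<close>, \<open>c - y + u\<close>, \<open>c - y\<close>: these carry a side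
  or diagonal of the symmetric hexagon to the opposite one.\<close>
lemma not_containment_property_compact:
  assumes F: "translates C \<subseteq> F" "F \<subseteq> homothets C"
  shows "\<not> containment_property (\<lambda>S. True) F 3"
proof
  assume three: "containment_property (\<lambda>S. True) F 3"
  obtain u x y c where u: "norm u = \<delta>" and conf: "config u x y c" and n: "x + y - c \<in> C"
    using inscribed_symmetric_hexagon by blast
  define m where "m = (1 / 2) *\<^sub>R (x + y)"
  define w where "w = x - y + u"
  have uw: "det2 u w > 0" and m: "m \<in> interior A"
    using config_geometry[OF conf] unfolding m_def w_def by auto
  have C: "x \<in> C" "x + u \<in> C" "y \<in> C" "y - u \<in> C" "c \<in> C"
    using conf unfolding config_def by auto
  have w0: "w \<noteq> 0" and u0: "u \<noteq> 0"
    using uw by auto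
  have xy: "x + y = 2 *\<^sub>R m"
    by (simp add: m_def)
  obtain s where s: "2 *\<^sub>R c - (x + y) = s *\<^sub>R w"
    using conf det2_eq_0_imp_parallel[OF _ w0] unfolding config_def w_def by blast
  have "0 \<le> (2 *\<^sub>R c - (x + y)) \<bullet> w"
    using conf unfolding config_def w_def by blast
  then have "0 \<le> s * (w \<bullet> w)" "w \<bullet> w > 0"
    using w0 unfolding s by simp_all
  then have "s \<ge> 0"
    using mult_neg_pos[of s "w \<bullet> w"] by linarith
  have c: "c = m + (s / 2) *\<^sub>R w"
  proof -
    have "c = m + (1 / 2) *\<^sub>R (2 *\<^sub>R c - (x + y))"
      unfolding xy by (simp add: vec_eq_iff field_simps)
    then show ?thesis
      unfolding s by simp
  qed
  \<comment> \<open>The point \<open>c\<close> moved outwards on the ray from \<open>m\<close>,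
    hence outside \<open>A\<close>.\<close>
  define d where "d = c + w"
  have "d \<notin> A"
  proof
    assume "d \<in> A"
    moreover have "d = m + (s / 2 + 1) *\<^sub>R w"
      unfolding d_def c by (simp add: scaleR_add_left)
    ultimately have "c \<in> interior A"
      using interior_before[OF m, of "s / 2 + 1" w "s / 2"] c \<open>s \<ge> 0\<close> by simp
    then show False
      using C(5) C_interior by blast
  qed
  have "c \<noteq> x"
  proof
    assume "c = x"
    then have "x - y = s *\<^sub>R w"
      unfolding s[symmetric] by (simp add: vec_eq_iff)
    then have "det2 w w = det2 (s *\<^sub>R w + u) w"
      unfolding w_def by simp
    then show False
      using uw by (simp add: det2_simps)
  qed
  have "c \<noteq> x + u"
  proof
    assume "c = x + u"
    then have "2 *\<^sub>R c - (x + y) = w + u"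
      unfolding w_def by (simp add: vec_eq_iff)
    then have "w + u = s *\<^sub>R w"
      using s by simp
    then have "det2 (w + u) w = det2 (s *\<^sub>R w) w"
      by simp
    then show False
      using uw by (simp add: det2_simps)
  qed
  have dist: "x \<noteq> x + u" "c \<noteq> x" "c \<noteq> x + u"
    using u0 \<open>c \<noteq> x\<close> \<open>c \<noteq> x + u\<close> by auto
  have d_new: "d \<noteq> x" "d \<noteq> x + u" "d \<noteq> c"
    using \<open>d \<notin> A\<close> C C_subset by auto
  have cover: "\<exists>T\<in>F. {p, q, r} \<subseteq> T" if "p - v \<in> C" "q - v \<in> C" "r - v \<in> C" for p q r v
  proof -
    have "{p, q, r} \<subseteq> (\<lambda>p. p + v) ` C"
      using that by (simp only: mem_translate_iff insert_subset) simp
    then show ?thesis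
      using F(1) unfolding translates_def by blast
  qed
  \<comment> \<open>Each shifted point is one of the hexagon vertices \<open>x\<close>,
    \<open>x + u\<close>, \<open>c\<close>, \<open>y\<close>, \<open>y - u\<close>,
    \<open>x + y - c\<close>.\<close>
  have diffs: "x - w = y - u" "x + u - w = y" "d - w = c"
      "x + u - (c - y + u) = x + y - c" "c - (c - y + u) = y - u" "d - (c - y + u) = x"
      "x - (c - y) = x + y - c" "c - (c - y) = y" "d - (c - y) = x + u"
    by (simp_all add: w_def d_def)
  have covers: "\<exists>T\<in>F. {x, x + u, c} \<subseteq> T" "\<exists>T\<in>F. {x, x + u, d} \<subseteq> T"
      "\<exists>T\<in>F. {x + u, c, d} \<subseteq> T" "\<exists>T\<in>F. {x, c, d} \<subseteq> T"
    by (rule cover[of _ 0] cover[of _ w] cover[of _ "c - y + u"] cover[of _ "c - y"];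
        simp only: diffs C n diff_zero)+
  have "\<exists>T\<in>F. S0 \<subseteq> T" if S0: "S0 \<subseteq> {x, x + u, c, d}" "finite S0" "card S0 \<le> 3" for S0
  proof -
    have "card {x, x + u, c, d} = 4"
      using dist d_new by auto
    then have "S0 \<noteq> {x, x + u, c, d}"
      using S0(3) by auto
    then have "S0 \<subseteq> {x, x + u, c} \<or> S0 \<subseteq> {x, x + u, d} \<or> S0 \<subseteq> {x + u, c, d} \<or> S0 \<subseteq> {x, c, d}"
      using S0(1) by blast
    then show ?thesis
      using covers by (meson order_trans)
  qed
  then obtain T where T: "T \<in> F" "{x, x + u, c, d} \<subseteq> T"
    using three unfolding containment_property_def by blast
  \<comment> \<open>The curve \<open>C\<close> itself already contains three of the four points, so
    \<open>T\<close> can only be \<open>C\<close>, which misses \<open>d\<close>.\<close>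
  have "C = (\<lambda>x. x + 0) ` C"
    by simp
  then have "C \<in> homothets C"
    using translates_subset_homothets[of C] unfolding translates_def by blast
  moreover have "card {x, x + u, c} = 3"
    using dist by auto
  ultimately have "T = C"
    using homothets_three_points[of T C "{x, x + u, c}"] T F(2) C by blast
  then show False
    using T(2) \<open>d \<notin> A\<close> C_subset by blast
qed

end

lemma (in strict_body) not_containment_property_bounded:
  assumes "bounded C" "p \<in> C" "q \<in> C" "p \<noteq> q" "translates C \<subseteq> F" "F \<subseteq> homothets C"
  shows "\<not> containment_property (\<lambda>S. True) F 3"
proof -
  have "midpoint p q \<in> open_segment p q"
    using assms(4) by simp
  then have "midpoint p q \<in> interior A"
    using interior_open_segment assms(2,3) C_subset by blast
  then obtain e where e: "e > 0" "cball (midpoint p q) e \<subseteq> A"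
    by (meson mem_interior_cball)
  have "bounded A"
    using bounded_if_bounded_frontier assms(1,2) by blast
  then interpret compact_strict_body A "midpoint p q" "e / 2"
    using e by unfold_locales auto
  show ?thesis
    using not_containment_property_compact assms(5,6) .
qed

subsection \<open>Translation and homothety orders\<close>

text \<open>A convex set and its closure have the same interior and hence the same frontier, so the
  set may be taken closed.\<close>

lemma convex_curve_body:
  assumes "convex_curve C"
  obtains A p q where "convex_body A" "C = frontier A" "p \<in> C" "q \<in> C" "p \<noteq> q"
proof -
  obtain B where B: "convex B" "C = frontier B"
    using assms unfolding convex_curve_def by blast
  have "frontier (closure B) = frontier B"
    using convex_interior_closure[OF B(1)] by (simp add: frontier_def)
  moreover have "convex_body (closure B)"
    using B(1) by unfold_locales (simp_all add: convex_closure)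
  ultimately show ?thesis
    using that[of "closure B"] B(2) assms unfolding convex_curve_def by metis
qed

lemma convex_curve_orders:
  assumes "convex_curve C"
  shows "compact_translation_order C \<le> 6" "compact_homothety_order C \<le> 6"
    "halflines_extend C \<Longrightarrow> translation_order C \<le> 6"
proof -
  obtain A p q where A: "convex_body A" "C = frontier A"
    using convex_curve_body[OF assms] by metis
  interpret convex_body A by fact
  have 6: "containment_order P F \<le> 6" if "containment_property P F 6" for P F
    using containment_order_le[OF that] by (simp add: numeral_eq_enat)
  show "compact_translation_order C \<le> 6"
    unfolding compact_translation_order_def A(2)
    by (intro 6 curve_family.containment_property_compact curve_family_homothets
        translates_subset_homothets)
  show "compact_homothety_order C \<le> 6"
    unfolding compact_homothety_order_def A(2)
    by (intro 6 curve_family.containment_property_compact curve_family_homothets) simp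
  assume he: "halflines_extend C"
  have "containment_property (\<lambda>S. True) (translates C) 6"
  \<comment> \<open>Half-lines in \<open>C\<close> extend to lines in \<open>C\<close>, so without a
    line there is no half-line either.\<close>
  proof (cases "\<exists>p u. u \<noteq> 0 \<and> (\<forall>t. p + t *\<^sub>R u \<in> C)")
    case True
    then have "containment_property (\<lambda>S. True) (translates C) 3"
      using containment_property_line[OF _ _ translates_subset_homothets] unfolding A(2) by blast
    then show ?thesis
      by (rule containment_property_mono) simp
  next
    case False
    then show ?thesis
      using containment_property_translates_no_ray he unfolding halflines_extend_def A(2) by metis
  qed
  then show "translation_order C \<le> 6"
    unfolding translation_order_def by (rule 6)
qed

lemma strictly_convex_curve_body:
  assumes "strictly_convex_curve C"
  obtains A p q where "strict_body A" "C = frontier A" "p \<in> C" "q \<in> C" "p \<noteq> q"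
proof -
  obtain A p q where A: "convex_body A" "C = frontier A" "p \<in> C" "q \<in> C" "p \<noteq> q"
    using convex_curve_body[of C] assms unfolding strictly_convex_curve_def by metis
  moreover have "strict_body A"
    using A assms unfolding strictly_convex_curve_def strict_body_def strict_body_axioms_def by simp
  ultimately show ?thesis
    using that by blast
qed

lemma strictly_convex_curve_orders:
  assumes "strictly_convex_curve C"
  shows "translation_order C \<le> 4" "homothety_order C \<le> 4"
    "bounded C \<Longrightarrow> translation_order C = 4" "bounded C \<Longrightarrow> homothety_order C = 4"
    "\<not> bounded C \<Longrightarrow> translation_order C = 3"
proof -
  obtain A p q where A: "strict_body A" "C = frontier A" "p \<in> C" "q \<in> C" "p \<noteq> q"
    using strictly_convex_curve_body[OF assms] by metis
  interpret strict_body A by fact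
  have four: "containment_property (\<lambda>S. True) (translates C) 4" "containment_property (\<lambda>S. True) (homothets C) 4"
    unfolding A(2) by (simp_all add: containment_property_strict translates_subset_homothets)
  show "translation_order C \<le> 4" "homothety_order C \<le> 4"
    unfolding translation_order_def homothety_order_def
    using four[THEN containment_order_le] by (simp_all add: numeral_eq_enat)
  show "translation_order C = 4" "homothety_order C = 4" if "bounded C"
    using containment_order_eqI[of "\<lambda>S. True" "translates C" 3] containment_order_eqI[of "\<lambda>S. True" "homothets C" 3]
      not_containment_property_bounded[of p q "translates C"] not_containment_property_bounded[of p q "homothets C"]
      that A four translates_subset_homothets[of C]
    unfolding translation_order_def homothety_order_def by (simp_all add: numeral_eq_enat)
  show "translation_order C = 3" if "\<not> bounded C"
  proof -
    have "\<not> bounded A"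
      using that A(2) C_subset bounded_subset by blast
    then show ?thesis
      using containment_order_eqI[of "\<lambda>S. True" "translates C" 2] that A(2)
        not_containment_property_unbounded containment_property_unbounded[of "\<lambda>S. True"]
      unfolding translation_order_def by (simp add: numeral_eq_enat)
  qed
qed

text \<open>A segment in \<open>C\<close> extends to a line in \<open>C\<close>. So either
  \<open>C\<close> contains a line, and three test points suffice, or \<open>C\<close> is strictly
  convex, and four do.\<close>

lemma segments_extend_homothety_order:
  assumes "convex_curve C" "segments_extend C"
  shows "homothety_order C \<le> 6"
proof (cases "\<exists>p u. u \<noteq> 0 \<and> (\<forall>t. p + t *\<^sub>R u \<in> C)")
  case True
  obtain A p q where A: "convex_body A" "C = frontier A"
    using convex_curve_body[OF assms(1)] by metis
  have "containment_property (\<lambda>S. True) (homothets C) 3"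
    using True convex_body.containment_property_line[OF A(1)] unfolding A(2) by blast
  then have "homothety_order C \<le> 3"
    unfolding homothety_order_def using containment_order_le by (simp add: numeral_eq_enat)
  also have "\<dots> \<le> 6"
    by simp
  finally show ?thesis .
next
  case False
  have "\<not> closed_segment a b \<subseteq> C" if "a \<noteq> b" for a b
  proof
    assume "closed_segment a b \<subseteq> C"
    moreover have "a + t *\<^sub>R (b - a) \<in> closed_segment a b" if "t \<in> {0..1}" for t
      using that unfolding in_segment by (intro exI[of _ t]) (auto simp: algebra_simps)
    ultimately have "\<forall>t\<in>{0..1}. a + t *\<^sub>R (b - a) \<in> C"
      by blast
    then show False
      using assms(2) False that unfolding segments_extend_def by (metis right_minus_eq)
  qed
  then have "homothety_order C \<le> 4"
    using strictly_convex_curve_orders(2) assms(1) unfolding strictly_convex_curve_def by blast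
  also have "\<dots> \<le> 6"
    by simp
  finally show ?thesis .
qed

theorem theorem1:
  fixes C :: "(real^2) set"
  shows
    "(convex_curve C \<longrightarrow>
        compact_translation_order C \<le> 6 \<and> compact_homothety_order C \<le> 6 \<and>
        (halflines_extend C \<longrightarrow> translation_order C \<le> 6) \<and>
        (segments_extend C \<longrightarrow> homothety_order C \<le> 6)) \<and>
     (strictly_convex_curve C \<longrightarrow>
        translation_order C \<le> 4 \<and> homothety_order C \<le> 4) \<and>
     (strictly_convex_curve C \<and> bounded C \<longrightarrow>
        translation_order C = 4 \<and> homothety_order C = 4) \<and>
     (strictly_convex_curve C \<and> \<not> bounded C \<longrightarrow> translation_order C = 3)"
  by (simp add: convex_curve_orders segments_extend_homothety_order strictly_convex_curve_orders)

end
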